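(* Let $T>0$. Given $\gamma\in(1,\infty)$, there exists a vector field $b\in L^1(0,T;W^{1,1}_{loc})$ that satisfies $$b\in L^\infty(0,T;L^\infty)\quad\text{and}\quad\operatorname{div}b\in L^1\left(0,T;\operatorname{Exp}\left(\tfrac{L}{\log^\gamma L}\right)\right),$$ such that for some $u_0\in C^\infty_c(\mathbb{R}^n)$ the Cauchy problem $$\begin{cases}\dfrac{\partial u}{\partial t}+b\cdot\nabla u=0 & \text{in }(0,T)\times\mathbb{R}^n,\\ u(0,\cdot)=u_0 & \text{in }\mathbb{R}^n\end{cases}$$ admits infinitely many weak solutions $u\in L^\infty(0,T;L^\infty)$.
   Context: All function spaces in the space variable are over $\mathbb{R}^n$ (e.g. $L^p=L^p(\mathbb{R}^n)$), $b=b(t,x)$ takes values in $\mathbb{R}^n$, and $\operatorname{div}$, $\nabla$ are with respect to $x$. $L^q(0,T;X)$ denotes the usual space of (classes of) functions $t\mapsto f(t,\cdot)\in X$ whose $X$-norm is in $L^q(0,T)$; for local spaces such as $W^{1,1}_{loc}$ this is required on every ball of $\mathbb{R}^n$. Orlicz space: let $\log^+t:=\max\{1,\log t\}$ and, for $\gamma\ge0$, $P(t)=\exp\left\{\frac{t}{(\log^+t)^\gamma}\right\}-1$ for $t\ge0$. Then $\operatorname{Exp}(\frac{L}{\log^\gamma L})$ is the set of measurable $f$ on $\mathbb{R}^n$ for which $$\|f\|_{\operatorname{Exp}(\frac{L}{\log^\gamma L})}=\inf\left\{\lambda>0:\int_{\mathbb{R}^n}P\left(\frac{|f(x)|}{\lambda}\right)dx\le1\right\}$$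 is finite. Weak solution: $u\in L^1(0,T;L^1_{loc})$ is a weak solution of the problem if for each $\varphi\in C^\infty([0,T]\times\mathbb{R}^n)$ with compact support in $[0,T)\times\mathbb{R}^n$, $$-\int_0^T\int_{\mathbb{R}^n}u\,\frac{\partial\varphi}{\partial t}\,dx\,dt-\int_{\mathbb{R}^n}u_0\,\varphi(0,\cdot)\,dx-\int_0^T\int_{\mathbb{R}^n}u\,\operatorname{div}(b\varphi)\,dx\,dt=0.$$ *)

theory Defs
  imports "HOL-Analysis.Analysis" "HOL-Probability.Essential_Supremum"
begin

section \<open>Smooth functions and test functions\<close>

text \<open>\<open>S\<close> may be open, or closed and convex with nonempty interior. In the latter case the
  derivatives at boundary points are the one-sided ones (they are still unique), so that
  \<open>smooth_on\<close> means smooth up to the boundary.\<close>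

primrec Ck_on :: "nat \<Rightarrow> 'a::euclidean_space set \<Rightarrow> ('a \<Rightarrow> real) \<Rightarrow> bool" where
  "Ck_on 0 S f \<longleftrightarrow> continuous_on S f"
| "Ck_on (Suc k) S f \<longleftrightarrow>
     f differentiable_on S \<and> (\<forall>v. Ck_on k S (\<lambda>x. frechet_derivative f (at x within S) v))"

definition smooth_on :: "'a::euclidean_space set \<Rightarrow> ('a \<Rightarrow> real) \<Rightarrow> bool" where
  "smooth_on S f \<longleftrightarrow> (\<forall>k. Ck_on k S f)"

definition Cc_smooth :: "'a::euclidean_space set \<Rightarrow> ('a \<Rightarrow> real) set" where
  "Cc_smooth \<Omega> = {f. smooth_on UNIV f \<and>
     compact (closure {x. f x \<noteq> 0}) \<and> closure {x. f x \<noteq> 0} \<subseteq> \<Omega>}"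

definition partial :: "'n::finite \<Rightarrow> (real ^ 'n \<Rightarrow> real) \<Rightarrow> real ^ 'n \<Rightarrow> real" where
  "partial i f x = frechet_derivative f (at x) (axis i 1)"

section \<open>Weak derivatives and norms in the space variable\<close>

text \<open>All spatial norms take values in \<^typ>\<open>ennreal\<close>; the corresponding space consists of the
  functions of finite norm, and non-measurable functions have norm \<open>\<infinity>\<close>.\<close>

definition locally_integrable ::
    "(real ^ 'n) set \<Rightarrow> (real ^ 'n \<Rightarrow> 'b::euclidean_space) \<Rightarrow> bool" where
  "locally_integrable \<Omega> f \<longleftrightarrow> (\<forall>K. compact K \<and> K \<subseteq> \<Omega> \<longrightarrow> set_integrable lebesgue K f)"

definition has_weak_partial ::
    "(real ^ 'n) set \<Rightarrow> 'n::finite \<Rightarrow> (real ^ 'n \<Rightarrow> 'b::euclidean_space) \<Rightarrow> (real ^ 'n \<Rightarrow> 'b) \<Rightarrow> bool"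
where
  "has_weak_partial \<Omega> i f g \<longleftrightarrow> locally_integrable \<Omega> f \<and> locally_integrable \<Omega> g \<and>
     (\<forall>\<psi>\<in>Cc_smooth \<Omega>. (LINT x:\<Omega>|lebesgue. partial i \<psi> x *\<^sub>R f x)
                      = - (LINT x:\<Omega>|lebesgue. \<psi> x *\<^sub>R g x))"

definition has_weak_div :: "(real ^ 'n \<Rightarrow> real ^ 'n) \<Rightarrow> (real ^ 'n::finite \<Rightarrow> real) \<Rightarrow> bool" where
  "has_weak_div F g \<longleftrightarrow> locally_integrable UNIV F \<and> locally_integrable UNIV g \<and>
     (\<forall>\<psi>\<in>Cc_smooth UNIV. (LINT x|lebesgue. (\<Sum>i\<in>UNIV. F x $ i * partial i \<psi> x))
                         = - (LINT x|lebesgue. g x * \<psi> x))"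

definition L1_norm :: "(real ^ 'n) set \<Rightarrow> (real ^ 'n::finite \<Rightarrow> 'b::euclidean_space) \<Rightarrow> ennreal" where
  "L1_norm \<Omega> f =
     (if f \<in> borel_measurable (lebesgue_on \<Omega>)
      then \<integral>\<^sup>+x. ennreal (norm (f x)) \<partial>lebesgue_on \<Omega> else \<infinity>)"

definition Linf_norm :: "(real ^ 'n::finite \<Rightarrow> 'b::euclidean_space) \<Rightarrow> ennreal" where
  "Linf_norm f =
     (if f \<in> borel_measurable lebesgue
      then esssup lebesgue (\<lambda>x. ennreal (norm (f x))) else \<infinity>)"

text \<open>Weak partial derivatives are unique almost everywhere, so the infimum ranges over a single
  value if they exist; otherwise it is \<open>\<infinity>\<close>.\<close>

definition W11_norm :: "(real ^ 'n) set \<Rightarrow> (real ^ 'n::finite \<Rightarrow> 'b::euclidean_space) \<Rightarrow> ennreal" where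
  "W11_norm \<Omega> f =
     Inf {L1_norm \<Omega> f + (\<Sum>i\<in>UNIV. L1_norm \<Omega> (G i)) | G. \<forall>i. has_weak_partial \<Omega> i f (G i)}"

definition log_plus :: "real \<Rightarrow> real" where
  "log_plus t = max 1 (ln t)"

definition orlicz_P :: "real \<Rightarrow> real \<Rightarrow> real" where
  "orlicz_P \<gamma> t = exp (t / log_plus t powr \<gamma>) - 1"

definition Exp_norm :: "real \<Rightarrow> (real ^ 'n::finite \<Rightarrow> real) \<Rightarrow> ennreal" where
  "Exp_norm \<gamma> f =
     (if f \<in> borel_measurable lebesgue
      then Inf {ennreal l | l. l > 0 \<and> (\<integral>\<^sup>+x. ennreal (orlicz_P \<gamma> (\<bar>f x\<bar> / l)) \<partial>lebesgue) \<le> 1}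
      else \<infinity>)"

section \<open>Spaces of time-dependent functions\<close>

text \<open>For a spatial norm \<open>N\<close>, \<open>L1_time T N\<close> and \<open>Linf_time T N\<close> are \<open>L\<^sup>1(0,T;X)\<close> and
  \<open>L\<^sup>\<infinity>(0,T;X)\<close>, where \<open>X\<close> is the space of functions of finite norm. Elements are
  representatives that are jointly Lebesgue measurable on the space-time slab.\<close>

definition slab :: "real \<Rightarrow> (real \<times> (real ^ 'n::finite)) set" where
  "slab T = {0<..<T} \<times> UNIV"

definition L1_time ::
    "real \<Rightarrow> ((real ^ 'n::finite \<Rightarrow> 'b::euclidean_space) \<Rightarrow> ennreal) \<Rightarrow> (real \<Rightarrow> real ^ 'n \<Rightarrow> 'b) set"
where
  "L1_time T N = {f.
     (\<lambda>(t, x). f t x) \<in> borel_measurable (lebesgue_on (slab T)) \<and>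
     (\<lambda>t. N (f t)) \<in> borel_measurable (lebesgue_on {0<..<T}) \<and>
     (\<integral>\<^sup>+t. N (f t) \<partial>lebesgue_on {0<..<T}) < \<infinity>}"

definition Linf_time ::
    "real \<Rightarrow> ((real ^ 'n::finite \<Rightarrow> 'b::euclidean_space) \<Rightarrow> ennreal) \<Rightarrow> (real \<Rightarrow> real ^ 'n \<Rightarrow> 'b) set"
where
  "Linf_time T N = {f.
     (\<lambda>(t, x). f t x) \<in> borel_measurable (lebesgue_on (slab T)) \<and>
     (\<lambda>t. N (f t)) \<in> borel_measurable (lebesgue_on {0<..<T}) \<and>
     esssup (lebesgue_on {0<..<T}) (\<lambda>t. N (f t)) < \<infinity>}"

definition L1_L1loc :: "real \<Rightarrow> (real \<Rightarrow> real ^ 'n::finite \<Rightarrow> 'b::euclidean_space) set" where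
  "L1_L1loc T = {f. \<forall>a r. r > 0 \<longrightarrow> f \<in> L1_time T (L1_norm (ball a r))}"

definition L1_W11loc :: "real \<Rightarrow> (real \<Rightarrow> real ^ 'n::finite \<Rightarrow> 'b::euclidean_space) set" where
  "L1_W11loc T = {f. \<forall>a r. r > 0 \<longrightarrow> f \<in> L1_time T (W11_norm (ball a r))}"

definition Linf_Linf :: "real \<Rightarrow> (real \<Rightarrow> real ^ 'n::finite \<Rightarrow> 'b::euclidean_space) set" where
  "Linf_Linf T = Linf_time T Linf_norm"

definition slab_ae_eq ::
    "real \<Rightarrow> ((real \<Rightarrow> real ^ 'n::finite \<Rightarrow> real) \<times> (real \<Rightarrow> real ^ 'n \<Rightarrow> real)) set" where
  "slab_ae_eq T = {(u, v). AE (t, x) in lebesgue_on (slab T). u t x = v t x}"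

text \<open>The divergence is a class of functions: the definition asks for a representative that is
  the distributional divergence of \<open>b(t,\<cdot>)\<close> for almost every \<open>t\<close>.\<close>

definition div_in_L1_Exp :: "real \<Rightarrow> real \<Rightarrow> (real \<Rightarrow> real ^ 'n::finite \<Rightarrow> real ^ 'n) \<Rightarrow> bool" where
  "div_in_L1_Exp T \<gamma> b \<longleftrightarrow>
     (\<exists>d\<in>L1_time T (Exp_norm \<gamma>). AE t in lebesgue_on {0<..<T}. has_weak_div (b t) (d t))"

section \<open>Weak solutions of the transport equation\<close>

text \<open>Smooth functions on \<open>[0,T] \<times> \<real>\<^sup>n\<close> with compact support in \<open>[0,T) \<times> \<real>\<^sup>n\<close>.\<close>

definition test_fun :: "real \<Rightarrow> (real \<times> (real ^ 'n::finite) \<Rightarrow> real) set" where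
  "test_fun T = {\<phi>. smooth_on ({0..T} \<times> UNIV) \<phi> \<and>
     (let supp = closure {p \<in> {0..T} \<times> UNIV. \<phi> p \<noteq> 0}
      in compact supp \<and> supp \<subseteq> {0..<T} \<times> UNIV)}"

text \<open>\<open>D t\<close> is the distributional divergence of \<open>b(t,\<cdot>) \<phi>(t,\<cdot>)\<close>. It is unique almost everywhere,
  so the last integral does not depend on the choice of \<open>D\<close>. The integrability clause only
  says that this integral is meaningful (Bochner integrals of non-integrable functions are 0).\<close>

definition weak_solution ::
    "real \<Rightarrow> (real \<Rightarrow> real ^ 'n::finite \<Rightarrow> real ^ 'n) \<Rightarrow> (real ^ 'n \<Rightarrow> real)
      \<Rightarrow> (real \<Rightarrow> real ^ 'n \<Rightarrow> real) \<Rightarrow> bool"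
where
  "weak_solution T b u0 u \<longleftrightarrow> u \<in> L1_L1loc T \<and>
     (\<forall>\<phi>\<in>test_fun T. \<exists>D.
        (AE t in lebesgue_on {0<..<T}. has_weak_div (\<lambda>x. \<phi> (t, x) *\<^sub>R b t x) (D t)) \<and>
        integrable (lebesgue_on (slab T)) (\<lambda>(t, x). u t x * D t x) \<and>
        - (LINT t|lebesgue_on {0<..<T}. LINT x|lebesgue. u t x * deriv (\<lambda>s. \<phi> (s, x)) t)
        - (LINT x|lebesgue. u0 x * \<phi> (0, x))
        - (LINT t|lebesgue_on {0<..<T}. LINT x|lebesgue. u t x * D t x) = 0)"

end

theory Submission
  imports Defs "HOL-Real_Asymp.Real_Asymp"
begin

text \<open>Let \<open>B\<close> be a \<open>C\<^sup>1\<close> vector field of compact support with \<open>B y = y\<close> on the unit ball, and let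
  \<open>b(t, x) = B(x / t)\<close>. For every \<open>t > 0\<close> this is a bounded \<open>C\<^sup>1\<close> field. Trajectories that leave the
  origin at time 0 are the rays \<open>x = t y\<close> with \<open>\<bar>y\<bar> < 1\<close>; they fill the ball \<open>\<bar>x\<bar> < t\<close>, and the initial
  datum says nothing about the values of \<open>u\<close> there. So with \<open>u\<^sub>0 = 0\<close> every multiple of the indicator
  function of the cone \<open>\<bar>x\<bar> < t\<close> is a bounded weak solution: since \<open>b(t, x) = x / t\<close> on the cone, the
  substitution \<open>x = t y\<close> gives
  \<open>\<integral>\<^bsub>\<bar>x\<bar> < t\<^esub> (\<partial>\<^sub>t \<phi> + div (b \<phi>)) dx = \<integral>\<^bsub>\<bar>y\<bar> < 1\<^esub> \<partial>\<^sub>t (t\<^sup>n \<phi>(t, t y)) dy\<close>,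
  and the integral over \<open>(0, T)\<close> vanishes by Fubini and the fundamental theorem of calculus
  (\<open>fan_weak_solution\<close>).

  The divergence \<open>(1 / t) (div B)(x / t)\<close> is of size \<open>1 / t\<close> on a set of measure of order \<open>t\<^sup>n\<close>. An
  amplitude \<open>L (log L)\<^sup>\<gamma>\<close> on such a set has Orlicz norm of order 1 when \<open>L\<close> is of order \<open>log (1 / t)\<close>, so
  the norm of the divergence is at most of order \<open>1 / (t log (1 / t) (log log (1 / t))\<^sup>\<gamma>)\<close>
  (\<open>Exp_norm_dilate_le\<close>). This is integrable near 0 because \<open>\<gamma> > 1\<close> (\<open>critical_integral_finite\<close>).
  The \<open>W\<^sup>1\<^sup>,\<^sup>1\<close> norms are bounded in \<open>t\<close>, because the factor \<open>1 / t\<close> of the gradient is compensated by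
  the volume \<open>t\<^sup>n\<close>.

  Measurability in time of the norms uses their structure: the essential supremum is invariant under
  dilations (\<open>Linf_norm_dilate\<close>), the Orlicz norm of a dilate is monotone (\<open>Exp_norm_dilate_mono\<close>),
  and the Sobolev norm, being an infimum, is upper semicontinuous in time
  (\<open>W11_norm_measurable_in_time\<close>).\<close>

section \<open>Continuously differentiable functions and integration by parts\<close>

text \<open>\<open>f\<close> is continuously differentiable with differential \<open>f'\<close>; continuity of the differential is
  stated direction by direction.\<close>

definition C1_with ::
    "('a::euclidean_space \<Rightarrow> 'b::euclidean_space) \<Rightarrow> ('a \<Rightarrow> 'a \<Rightarrow> 'b) \<Rightarrow> bool" where
  "C1_with f f' \<longleftrightarrow> (\<forall>x. (f has_derivative f' x) (at x)) \<and> (\<forall>v. continuous_on UNIV (\<lambda>x. f' x v))"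

lemma C1_withD:
  assumes "C1_with f f'"
  shows "(f has_derivative f' x) (at x)" "continuous_on UNIV (\<lambda>x. f' x v)" "continuous_on UNIV f"
  using assms unfolding C1_with_def
  by (auto intro!: continuous_at_imp_continuous_on has_derivative_continuous)

lemma integrable_continuous_compact_support:
  fixes f :: "'a::euclidean_space \<Rightarrow> 'b::{banach, second_countable_topology}"
  assumes "continuous_on UNIV f" "compact K" "\<And>x. x \<notin> K \<Longrightarrow> f x = 0"
  shows "integrable lborel f"
proof -
  have "integrable lborel (\<lambda>x. indicator K x *\<^sub>R f x)"
    using assms by (intro borel_integrable_compact) (auto intro: continuous_on_subset)
  also have "(\<lambda>x. indicator K x *\<^sub>R f x) = f"
    using assms(3) by (auto simp: indicator_def fun_eq_iff)
  finally show ?thesis .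
qed

lemma derivative_zero_outside_support:
  assumes "(g has_derivative D) (at x)" "closed K" "\<And>x. x \<notin> K \<Longrightarrow> g x = 0" "x \<notin> K"
  shows "D v = 0"
proof -
  have "(g has_derivative (\<lambda>_. 0)) (at x)"
    by (rule has_derivative_transform_within_open[OF has_derivative_const, of "- K"])
       (use assms in auto)
  with assms(1) have "D = (\<lambda>_. 0)" by (rule has_derivative_unique)
  then show ?thesis by simp
qed

lemma bounded_continuous_compact_support:
  fixes f :: "'a::euclidean_space \<Rightarrow> 'b::real_normed_vector"
  assumes "continuous_on UNIV f" "compact K" "\<And>x. x \<notin> K \<Longrightarrow> f x = 0"
  obtains M where "M > 0" "\<And>x. norm (f x) \<le> M"
proof -
  have "bounded (f ` K)"
    using assms by (intro compact_imp_bounded compact_continuous_image) (auto intro: continuous_on_subset)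
  then obtain M where M: "M > 0" "\<And>x. x \<in> K \<Longrightarrow> norm (f x) \<le> M"
    by (auto simp: bounded_pos)
  have "norm (f x) \<le> M" for x
    by (cases "x \<in> K") (use M assms(3) in auto)
  with M(1) that show thesis by blast
qed

text \<open>The integral of a difference quotient vanishes by translation invariance; the difference
  quotients converge dominatedly to the derivative.\<close>

lemma integral_derivative_compact_support:
  fixes g :: "'a::euclidean_space \<Rightarrow> 'b::euclidean_space"
  assumes g: "C1_with g g'" and K: "compact K" and supp: "\<And>x. x \<notin> K \<Longrightarrow> g x = 0"
  shows "(LINT x|lborel. g' x v) = 0"
proof -
  note der = C1_withD(1)[OF g] and cont = C1_withD(2)[OF g] and gc = C1_withD(3)[OF g]
  have supp': "g' x v = 0" if "x \<notin> K" for x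
    using derivative_zero_outside_support[OF der compact_imp_closed[OF K] supp that] by simp
  obtain M where M: "M > 0" "\<And>x. norm (g' x v) \<le> M"
    using bounded_continuous_compact_support[OF cont K supp'] by blast
  obtain R where R: "K \<subseteq> cball 0 R"
    using bounded_subset_ballD[OF compact_imp_bounded[OF K], of 0] ball_subset_cball by (metis order_trans)
  have gi: "integrable lborel g"
    by (rule integrable_continuous_compact_support[OF gc K supp])
  have gm[measurable]: "g \<in> borel_measurable borel"
    using gc by (rule borel_measurable_continuous_onI)
  have g'm[measurable]: "(\<lambda>x. g' x v) \<in> borel_measurable borel"
    using cont by (rule borel_measurable_continuous_onI)
  define h :: "nat \<Rightarrow> real" where "h k = 1 / real (Suc k)" for k
  have h: "h k > 0" "h k \<le> 1" for k by (auto simp: h_def)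
  \<comment> \<open>difference quotients with step \<open>h k\<close>, supported in a fixed ball and bounded by \<open>M\<close>\<close>
  define s where "s k x = (1 / h k) *\<^sub>R (g (x + h k *\<^sub>R v) - g x)" for k x
  have translate: "integrable lborel (\<lambda>x. g (x + w))" "(LINT x|lborel. g (x + w)) = (LINT x|lborel. g x)" for w
  proof -
    have "integrable (distr lborel borel ((+) w)) g"
      by (subst lborel_distr_plus) (rule gi)
    then show "integrable lborel (\<lambda>x. g (x + w))"
      by (simp add: integrable_distr_eq add.commute)
    have "(LINT x|distr lborel borel ((+) w). g x) = (LINT x|lborel. g (x + w))"
      by (subst integral_distr) (auto simp: add.commute)
    then show "(LINT x|lborel. g (x + w)) = (LINT x|lborel. g x)"
      by (simp add: lborel_distr_plus)
  qed
  have s0: "(LINT x|lborel. s k x) = 0" for k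
    unfolding s_def by (simp add: translate gi)
  have pd: "((\<lambda>\<tau>. g (x + \<tau> *\<^sub>R v)) has_derivative (\<lambda>y. y *\<^sub>R g' (x + \<tau> *\<^sub>R v) v)) (at \<tau>)" for x \<tau>
  proof -
    have "((\<lambda>\<tau>. x + \<tau> *\<^sub>R v) has_derivative (\<lambda>y. y *\<^sub>R v)) (at \<tau>)"
      by (auto intro!: derivative_eq_intros)
    from has_derivative_compose[OF this der]
    have "((\<lambda>\<tau>. g (x + \<tau> *\<^sub>R v)) has_derivative (\<lambda>y. g' (x + \<tau> *\<^sub>R v) (y *\<^sub>R v))) (at \<tau>)" .
    moreover have "g' (x + \<tau> *\<^sub>R v) (y *\<^sub>R v) = y *\<^sub>R g' (x + \<tau> *\<^sub>R v) v" for y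
      using has_derivative_bounded_linear[OF der] by (simp add: linear_simps)
    ultimately show ?thesis by simp
  qed
  have bound: "norm (s k x) \<le> M" for k x
  proof -
    have "norm (g (x + h k *\<^sub>R v) - g (x + 0 *\<^sub>R v)) \<le> M * norm (h k - 0)"
    proof (rule differentiable_bound[of UNIV _ "\<lambda>\<tau> y. y *\<^sub>R g' (x + \<tau> *\<^sub>R v) v"])
      show "onorm (\<lambda>y. y *\<^sub>R g' (x + \<tau> *\<^sub>R v) v) \<le> M" for \<tau>
        by (rule onorm_le) (use M in \<open>simp add: mult.commute[of M] mult_left_mono\<close>)
    qed (use pd in auto)
    then have "norm (g (x + h k *\<^sub>R v) - g x) \<le> M * h k" using h[of k] by simp
    then show ?thesis using h[of k] by (simp add: s_def divide_le_eq)
  qed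
  have zero: "s k x = 0" if "x \<notin> cball 0 (R + norm v)" for k x
  proof -
    have "x \<notin> K" using that R norm_ge_zero[of v] by (force simp del: norm_ge_zero)
    moreover have "x + h k *\<^sub>R v \<notin> K"
    proof
      assume "x + h k *\<^sub>R v \<in> K"
      then have "norm (x + h k *\<^sub>R v) \<le> R" using R by auto
      moreover have "norm x \<le> norm (x + h k *\<^sub>R v) + norm (h k *\<^sub>R v)"
        by (metis add_diff_cancel_right' norm_triangle_ineq4)
      moreover have "norm (h k *\<^sub>R v) \<le> norm v" using h[of k] by (simp add: mult_left_le_one_le)
      ultimately show False using that by auto
    qed
    ultimately show ?thesis by (simp add: s_def supp)
  qed
  have lim: "(\<lambda>k. s k x) \<longlonglongrightarrow> g' x v" for x
  proof -
    have D: "((\<lambda>y. norm (g (x + y *\<^sub>R v) - g x - y *\<^sub>R g' x v) / norm y) \<longlongrightarrow> 0) (at 0)"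
      using pd[of x 0] by (simp add: has_derivative_at)
    have "h \<longlonglongrightarrow> 0" unfolding h_def using lim_1_over_n[where 'a=real] LIMSEQ_Suc by blast
    then have "filterlim h (at 0) sequentially"
      using h(1) by (simp add: filterlim_at less_imp_neq[symmetric])
    from filterlim_compose[OF D this]
    have "(\<lambda>k. norm (g (x + h k *\<^sub>R v) - g x - h k *\<^sub>R g' x v) / norm (h k)) \<longlonglongrightarrow> 0" .
    also have "(\<lambda>k. norm (g (x + h k *\<^sub>R v) - g x - h k *\<^sub>R g' x v) / norm (h k)) = (\<lambda>k. norm (s k x - g' x v))"
    proof
      fix k
      have "s k x - g' x v = (1 / h k) *\<^sub>R (g (x + h k *\<^sub>R v) - g x - h k *\<^sub>R g' x v)"
        using h(1)[of k] by (simp add: s_def scaleR_diff_right)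
      then show "norm (g (x + h k *\<^sub>R v) - g x - h k *\<^sub>R g' x v) / norm (h k) = norm (s k x - g' x v)"
        using h(1)[of k] by simp
    qed
    finally show ?thesis using LIM_zero_iff tendsto_norm_zero_iff by blast
  qed
  have "(\<lambda>k. LINT x|lborel. s k x) \<longlonglongrightarrow> (LINT x|lborel. g' x v)"
  proof (rule integral_dominated_convergence[where w = "\<lambda>x. M * indicator (cball 0 (R + norm v)) x"])
    show "integrable lborel (\<lambda>x. M * indicator (cball 0 (R + norm v)) (x::'a))"
      by (intro integrable_mult_right integrable_real_indicator)
        (use emeasure_bounded_finite[OF bounded_cball, of "0::'a" "R + norm v"] in auto)
    show "AE x in lborel. norm (s k x) \<le> M * indicator (cball 0 (R + norm v)) x" for k
      using bound[of k] zero[of _ k] by (auto simp: indicator_def)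
    show "AE x in lborel. (\<lambda>k. s k x) \<longlonglongrightarrow> g' x v" using lim by simp
  qed (auto simp: s_def)
  then show ?thesis by (simp add: s0 LIMSEQ_const_iff)
qed

lemma Cc_smooth_C1:
  assumes "\<psi> \<in> Cc_smooth \<Omega>"
  shows "C1_with \<psi> (\<lambda>x. frechet_derivative \<psi> (at x))"
proof -
  have "Ck_on (Suc (Suc 0)) UNIV \<psi>" using assms unfolding Cc_smooth_def smooth_on_def by blast
  then show ?thesis
    by (auto simp: C1_with_def differentiable_on_def frechet_derivative_works
        intro!: differentiable_imp_continuous_on)
qed

lemma Cc_smooth_support:
  assumes "\<psi> \<in> Cc_smooth \<Omega>"
  obtains K where "compact K" "K \<subseteq> \<Omega>" "\<And>x. x \<notin> K \<Longrightarrow> \<psi> x = 0"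
  using assms closure_subset[of "{x. \<psi> x \<noteq> 0}"]
  by (intro that[of "closure {x. \<psi> x \<noteq> 0}"]) (auto simp: Cc_smooth_def)

lemma integral_by_parts_C1:
  fixes f :: "real ^ 'n::finite \<Rightarrow> 'b::euclidean_space"
  assumes \<psi>: "\<psi> \<in> Cc_smooth \<Omega>" and f: "C1_with f f'"
  shows "(LINT x|lborel. partial i \<psi> x *\<^sub>R f x) = - (LINT x|lborel. \<psi> x *\<^sub>R f' x (axis i 1))" (is ?eq)
    and "integrable lborel (\<lambda>x. partial i \<psi> x *\<^sub>R f x)"
    and "integrable lborel (\<lambda>x. \<psi> x *\<^sub>R f' x (axis i 1))"
proof -
  obtain K where K: "compact K" "\<And>x. x \<notin> K \<Longrightarrow> \<psi> x = 0" using Cc_smooth_support[OF \<psi>] by metis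
  note c = Cc_smooth_C1[OF \<psi>]
  have z: "partial i \<psi> x = 0" if "x \<notin> K" for x
    unfolding partial_def
    by (rule derivative_zero_outside_support[OF C1_withD(1)[OF c] compact_imp_closed[OF K(1)] K(2) that])
  have cp: "continuous_on UNIV (partial i \<psi>)"
    unfolding partial_def[abs_def] by (rule C1_withD(2)[OF c])
  show 1: "integrable lborel (\<lambda>x. partial i \<psi> x *\<^sub>R f x)"
    by (rule integrable_continuous_compact_support[OF _ K(1)])
       (auto intro!: continuous_intros cp C1_withD(3)[OF f] simp: z)
  show 2: "integrable lborel (\<lambda>x. \<psi> x *\<^sub>R f' x (axis i 1))"
    by (rule integrable_continuous_compact_support[OF _ K(1)])
       (auto intro!: continuous_intros C1_withD(3)[OF c] C1_withD(2)[OF f] simp: K(2))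
  have "C1_with (\<lambda>x. \<psi> x *\<^sub>R f x) (\<lambda>x v. \<psi> x *\<^sub>R f' x v + frechet_derivative \<psi> (at x) v *\<^sub>R f x)"
    unfolding C1_with_def
    by (auto intro!: continuous_intros has_derivative_scaleR C1_withD(1-3)[OF c] C1_withD(1-3)[OF f])
  from integral_derivative_compact_support[OF this K(1)]
  have "(LINT x|lborel. \<psi> x *\<^sub>R f' x (axis i 1) + partial i \<psi> x *\<^sub>R f x) = 0"
    by (simp add: K(2) partial_def)
  then show ?eq using 1 2 by (simp add: add_eq_0_iff)
qed

lemma locally_integrable_continuous:
  fixes f :: "real ^ 'n::finite \<Rightarrow> 'b::euclidean_space"
  assumes "continuous_on UNIV f"
  shows "locally_integrable \<Omega> f"
  unfolding locally_integrable_def set_integrable_def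
proof safe
  fix K :: "(real ^ 'n) set" assume "compact K"
  then have "integrable lborel (\<lambda>x. indicator K x *\<^sub>R f x)"
    using assms by (intro borel_integrable_compact) (auto intro: continuous_on_subset)
  then show "integrable lebesgue (\<lambda>x. indicator K x *\<^sub>R f x)"
    by (intro integrable_completion[THEN iffD2]) (auto dest: borel_measurable_integrable)
qed

lemma has_weak_partial_C1:
  fixes f :: "real ^ 'n::finite \<Rightarrow> 'b::euclidean_space"
  assumes f: "C1_with f f'"
  shows "has_weak_partial \<Omega> i f (\<lambda>x. f' x (axis i 1))"
  unfolding has_weak_partial_def
proof (intro conjI ballI locally_integrable_continuous C1_withD(2,3)[OF f])
  fix \<psi> :: "real ^ 'n \<Rightarrow> real" assume \<psi>: "\<psi> \<in> Cc_smooth \<Omega>"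
  obtain K where K: "compact K" "K \<subseteq> \<Omega>" "\<And>x. x \<notin> K \<Longrightarrow> \<psi> x = 0" using Cc_smooth_support[OF \<psi>] by metis
  have z: "partial i \<psi> x = 0" if "x \<notin> K" for x
    unfolding partial_def
    by (rule derivative_zero_outside_support[OF C1_withD(1)[OF Cc_smooth_C1[OF \<psi>]] compact_imp_closed[OF K(1)] K(3) that])
  have "(LINT x:\<Omega>|lebesgue. partial i \<psi> x *\<^sub>R f x) = (LINT x|lebesgue. partial i \<psi> x *\<^sub>R f x)"
    unfolding set_lebesgue_integral_def using z K(2)
    by (intro Bochner_Integration.integral_cong) (auto simp: indicator_def)
  moreover have "(LINT x:\<Omega>|lebesgue. \<psi> x *\<^sub>R f' x (axis i 1)) = (LINT x|lebesgue. \<psi> x *\<^sub>R f' x (axis i 1))"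
    unfolding set_lebesgue_integral_def using K(2,3)
    by (intro Bochner_Integration.integral_cong) (auto simp: indicator_def)
  ultimately show "(LINT x:\<Omega>|lebesgue. partial i \<psi> x *\<^sub>R f x)
      = - (LINT x:\<Omega>|lebesgue. \<psi> x *\<^sub>R f' x (axis i 1))"
    using integral_by_parts_C1[OF \<psi> f, of i]
    by (simp add: integral_completion borel_measurable_integrable)
qed

lemma has_weak_div_C1:
  fixes F :: "real ^ 'n::finite \<Rightarrow> real ^ 'n"
  assumes F: "C1_with F F'"
  shows "has_weak_div F (\<lambda>x. \<Sum>i\<in>UNIV. F' x (axis i 1) $ i)"
  unfolding has_weak_div_def
proof (intro conjI ballI locally_integrable_continuous C1_withD(2,3)[OF F])
  show "continuous_on UNIV (\<lambda>x. \<Sum>i\<in>UNIV. F' x (axis i 1) $ i)"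
    by (intro continuous_intros C1_withD(2)[OF F])
  fix \<psi> :: "real ^ 'n \<Rightarrow> real" assume \<psi>: "\<psi> \<in> Cc_smooth UNIV"
  have c: "C1_with (\<lambda>x. F x $ i) (\<lambda>x v. F' x v $ i)" for i
    using F unfolding C1_with_def
    by (auto intro!: continuous_intros bounded_linear.has_derivative[OF bounded_linear_vec_nth])
  note ibp = integral_by_parts_C1[OF \<psi> c]
  have 1: "integrable lborel (\<lambda>x. F x $ i * partial i \<psi> x)" for i
    using ibp(2)[of i i] by (simp add: mult.commute)
  have 2: "integrable lborel (\<lambda>x. F' x (axis i 1) $ i * \<psi> x)" for i
    using ibp(3)[of i i] by (simp add: mult.commute)
  have "(LINT x|lborel. (\<Sum>i\<in>UNIV. F x $ i * partial i \<psi> x)) = (\<Sum>i\<in>UNIV. LINT x|lborel. F x $ i * partial i \<psi> x)"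
    using 1 by simp
  also have "\<dots> = (\<Sum>i\<in>UNIV. - (LINT x|lborel. F' x (axis i 1) $ i * \<psi> x))"
    using ibp(1) by (intro sum.cong) (simp_all add: mult.commute)
  also have "\<dots> = - (LINT x|lborel. (\<Sum>i\<in>UNIV. F' x (axis i 1) $ i) * \<psi> x)"
    using 2 by (simp add: sum_distrib_right sum_negf)
  finally show "(LINT x|lebesgue. (\<Sum>i\<in>UNIV. F x $ i * partial i \<psi> x))
      = - (LINT x|lebesgue. (\<Sum>i\<in>UNIV. F' x (axis i 1) $ i) * \<psi> x)"
    using 1 2 by (subst (1 2) integral_completion)
      (auto simp: sum_distrib_right intro!: borel_measurable_sum borel_measurable_integrable)
qed

section \<open>Dilations\<close>

lemma
  fixes t :: real assumes "t \<noteq> 0"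
  shows lebesgue_scaleR: "(lebesgue :: 'a::euclidean_space measure)
           = density (distr lebesgue lebesgue (\<lambda>x. t *\<^sub>R x)) (\<lambda>_. ennreal (\<bar>t\<bar> ^ DIM('a)))"
    and measurable_lebesgue_scaleR: "(\<lambda>x::'a. t *\<^sub>R x) \<in> lebesgue \<rightarrow>\<^sub>M lebesgue"
proof -
  have eq: "(\<lambda>x::'a. 0 + (\<Sum>j\<in>Basis. (t * (x \<bullet> j)) *\<^sub>R j)) = (\<lambda>x. t *\<^sub>R x)"
    by (simp flip: scaleR_scaleR add: scaleR_sum_right[symmetric] euclidean_representation)
  show "(lebesgue :: 'a measure)
           = density (distr lebesgue lebesgue (\<lambda>x. t *\<^sub>R x)) (\<lambda>_. ennreal (\<bar>t\<bar> ^ DIM('a)))"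
    using lebesgue_affine_euclidean[of "\<lambda>_. t" "0::'a"] assms by (simp add: eq[simplified])
  show "(\<lambda>x::'a. t *\<^sub>R x) \<in> lebesgue \<rightarrow>\<^sub>M lebesgue"
    using lebesgue_affine_measurable[of "\<lambda>_. t" "0::'a"] assms by (simp add: eq[simplified])
qed

lemma measurable_dilate:
  assumes "f \<in> borel_measurable lebesgue" "t > 0"
  shows "(\<lambda>x. f (x /\<^sub>R t)) \<in> borel_measurable lebesgue"
  using measurable_compose[OF measurable_lebesgue_scaleR[of "inverse t"] assms(1)] assms(2) by simp

lemma nn_integral_dilate:
  fixes f :: "'a::euclidean_space \<Rightarrow> ennreal"
  assumes [measurable]: "f \<in> borel_measurable lebesgue" and t: "t > 0"
  shows "(\<integral>\<^sup>+x. f (x /\<^sub>R t) \<partial>lebesgue) = ennreal (t ^ DIM('a)) * (\<integral>\<^sup>+x. f x \<partial>lebesgue)"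
proof -
  note [measurable] = measurable_dilate[OF assms] measurable_lebesgue_scaleR
  show ?thesis
    using t by (subst lebesgue_scaleR[of t])
      (simp_all add: nn_integral_density nn_integral_distr nn_integral_cmult measurable_lebesgue_scaleR)
qed

lemma AE_dilate:
  assumes "AE x in lebesgue. P x" and P: "{x. P x} \<in> sets lebesgue" and t: "t > 0"
  shows "AE x in lebesgue. P (x /\<^sub>R t)"
proof -
  have "(\<lambda>x. x /\<^sub>R t) -` {x. P x} \<inter> space lebesgue \<in> sets lebesgue"
    using measurable_sets[OF measurable_lebesgue_scaleR P, of "inverse t"] t by simp
  then have "{x. P (x /\<^sub>R t)} \<in> sets lebesgue" by (simp add: vimage_def)
  then show ?thesis
    using assms by (subst lebesgue_scaleR[of t])
      (simp_all add: AE_density AE_distr_iff measurable_lebesgue_scaleR)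
qed

text \<open>Dilation-invariance of the essential supremum.\<close>

lemma Linf_norm_dilate:
  fixes f :: "real ^ 'n::finite \<Rightarrow> 'b::euclidean_space"
  assumes t: "t > 0"
  shows "Linf_norm (\<lambda>x. f (x /\<^sub>R t)) = Linf_norm f"
proof -
  have le: "Linf_norm (\<lambda>x. g (x /\<^sub>R s)) \<le> Linf_norm g" if s: "s > 0" for s and g :: "real ^ 'n \<Rightarrow> 'b"
  proof (cases "g \<in> borel_measurable lebesgue")
    case True
    note [measurable] = True measurable_dilate[OF True s]
    let ?P = "\<lambda>x. ennreal (norm (g x)) \<le> esssup lebesgue (\<lambda>x. ennreal (norm (g x)))"
    have "{x \<in> space lebesgue. ?P x} \<in> sets lebesgue" by measurable
    then have "{x. ?P x} \<in> sets lebesgue" by simp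
    from AE_dilate[OF esssup_AE this s]
    have "esssup lebesgue (\<lambda>x. ennreal (norm (g (x /\<^sub>R s)))) \<le> esssup lebesgue (\<lambda>x. ennreal (norm (g x)))"
      by (intro esssup_I) auto
    then show ?thesis by (simp add: Linf_norm_def)
  qed (simp add: Linf_norm_def)
  have "f = (\<lambda>x. f ((x /\<^sub>R inverse t) /\<^sub>R t))" using t by auto
  then have "Linf_norm f \<le> Linf_norm (\<lambda>x. f (x /\<^sub>R t))"
    using le[of "inverse t" "\<lambda>x. f (x /\<^sub>R t)"] t by simp
  with le[OF t, of f] show ?thesis by (rule antisym)
qed

lemma borel_measurable_mono_on_Ioo:
  fixes f :: "real \<Rightarrow> 'a::{linorder_topology, second_countable_topology}"
  assumes "mono_on {a<..<b} f"
  shows "f \<in> borel_measurable (lebesgue_on {a<..<b})"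
proof (rule borel_measurableI_less)
  fix y
  have "is_interval {x \<in> {a<..<b}. f x < y}"
    unfolding is_interval_1
  proof (intro ballI allI impI)
    fix p q x assume *: "p \<in> {x \<in> {a<..<b}. f x < y}" "q \<in> {x \<in> {a<..<b}. f x < y}" "p \<le> x \<and> x \<le> q"
    then have x: "x \<in> {a<..<b}" by auto
    then have "f x \<le> f q" using * monotone_onD[OF assms, of x q] by auto
    then show "x \<in> {x \<in> {a<..<b}. f x < y}" using * x by auto
  qed
  then have "{x \<in> {a<..<b}. f x < y} \<in> sets lebesgue"
    by (intro sets_completionI_sets) (simp add: real_interval_borel_measurable)
  then show "{x \<in> space (lebesgue_on {a<..<b}). f x < y} \<in> sets (lebesgue_on {a<..<b})"
    by (subst sets_restrict_space_iff) auto
qed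

section \<open>Weak derivatives and the Sobolev norm\<close>

lemma set_integrable_test:
  fixes f :: "real ^ 'n::finite \<Rightarrow> 'b::euclidean_space"
  assumes f: "locally_integrable \<Omega> f" and \<eta>: "continuous_on UNIV \<eta>"
    and K: "compact K" "K \<subseteq> \<Omega>" "\<And>x. x \<notin> K \<Longrightarrow> \<eta> x = 0"
  shows "set_integrable lebesgue \<Omega> (\<lambda>x. \<eta> x *\<^sub>R f x)"
proof -
  obtain M where M: "M > 0" "\<And>x. norm (\<eta> x) \<le> M"
    using bounded_continuous_compact_support[OF \<eta> K(1,3)] by blast
  have 1: "integrable lebesgue (\<lambda>x. indicator K x *\<^sub>R f x)"
    using f K unfolding locally_integrable_def set_integrable_def by blast
  have [measurable]: "\<eta> \<in> borel_measurable lebesgue"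
    using borel_measurable_continuous_onI[OF \<eta>] by (simp add: measurable_completion)
  note [measurable] = borel_measurable_integrable[OF 1]
  have "integrable lebesgue (\<lambda>x. \<eta> x *\<^sub>R (indicator K x *\<^sub>R f x))"
  proof (rule Bochner_Integration.integrable_bound)
    show "integrable lebesgue (\<lambda>x. M *\<^sub>R (indicator K x *\<^sub>R f x))" using 1 by (rule integrable_scaleR_right)
    show "AE x in lebesgue. norm (\<eta> x *\<^sub>R (indicator K x *\<^sub>R f x)) \<le> norm (M *\<^sub>R (indicator K x *\<^sub>R f x))"
      using M by (intro AE_I2) (auto simp: indicator_def intro!: mult_right_mono)
  qed measurable
  also have "(\<lambda>x. \<eta> x *\<^sub>R (indicator K x *\<^sub>R f x)) = (\<lambda>x. indicator \<Omega> x *\<^sub>R (\<eta> x *\<^sub>R f x))"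
    using K by (auto simp: indicator_def fun_eq_iff)
  finally show ?thesis by (simp add: set_integrable_def)
qed

lemma has_weak_partial_add:
  fixes f g :: "real ^ 'n::finite \<Rightarrow> 'b::euclidean_space"
  assumes f: "has_weak_partial \<Omega> i f F" and g: "has_weak_partial \<Omega> i g G"
  shows "has_weak_partial \<Omega> i (\<lambda>x. f x + g x) (\<lambda>x. F x + G x)"
  unfolding has_weak_partial_def
proof (intro conjI ballI)
  show "locally_integrable \<Omega> (\<lambda>x. f x + g x)" "locally_integrable \<Omega> (\<lambda>x. F x + G x)"
    using f g by (auto simp: has_weak_partial_def locally_integrable_def intro!: set_integral_add)
  fix \<psi> :: "real ^ 'n \<Rightarrow> real" assume \<psi>: "\<psi> \<in> Cc_smooth \<Omega>"
  obtain K where K: "compact K" "K \<subseteq> \<Omega>" "\<And>x. x \<notin> K \<Longrightarrow> \<psi> x = 0" using Cc_smooth_support[OF \<psi>] by metis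
  note c = Cc_smooth_C1[OF \<psi>]
  have z: "partial i \<psi> x = 0" if "x \<notin> K" for x
    unfolding partial_def
    by (rule derivative_zero_outside_support[OF C1_withD(1)[OF c] compact_imp_closed[OF K(1)] K(3) that])
  have cp: "continuous_on UNIV (partial i \<psi>)"
    unfolding partial_def[abs_def] by (rule C1_withD(2)[OF c])
  have 1: "set_integrable lebesgue \<Omega> (\<lambda>x. partial i \<psi> x *\<^sub>R h x)" if "locally_integrable \<Omega> h"
    for h :: "real ^ 'n \<Rightarrow> 'b"
    by (rule set_integrable_test[OF that cp K(1,2) z])
  have 2: "set_integrable lebesgue \<Omega> (\<lambda>x. \<psi> x *\<^sub>R h x)" if "locally_integrable \<Omega> h"
    for h :: "real ^ 'n \<Rightarrow> 'b"
    by (rule set_integrable_test[OF that C1_withD(3)[OF c] K])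
  show "(LINT x:\<Omega>|lebesgue. partial i \<psi> x *\<^sub>R (f x + g x)) = - (LINT x:\<Omega>|lebesgue. \<psi> x *\<^sub>R (F x + G x))"
    using f g \<psi> by (simp add: scaleR_add_right set_integral_add 1 2 has_weak_partial_def)
qed

lemma L1_norm_add:
  "L1_norm \<Omega> (\<lambda>x. f x + g x) \<le> L1_norm \<Omega> f + L1_norm \<Omega> g"
proof (cases "f \<in> borel_measurable (lebesgue_on \<Omega>) \<and> g \<in> borel_measurable (lebesgue_on \<Omega>)")
  case True
  then have [measurable]: "f \<in> borel_measurable (lebesgue_on \<Omega>)" "g \<in> borel_measurable (lebesgue_on \<Omega>)" by auto
  have "(\<integral>\<^sup>+x. ennreal (norm (f x + g x)) \<partial>lebesgue_on \<Omega>)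
      \<le> (\<integral>\<^sup>+x. ennreal (norm (f x)) + ennreal (norm (g x)) \<partial>lebesgue_on \<Omega>)"
    by (intro nn_integral_mono) (auto simp flip: ennreal_plus intro: norm_triangle_ineq)
  then show ?thesis by (simp add: L1_norm_def nn_integral_add)
qed (auto simp: L1_norm_def)

text \<open>The functional whose infimum is the Sobolev norm, for a given family of weak derivatives.\<close>

definition W11_sum ::
    "(real ^ 'n) set \<Rightarrow> (real ^ 'n::finite \<Rightarrow> 'b::euclidean_space) \<Rightarrow> ('n \<Rightarrow> real ^ 'n \<Rightarrow> 'b) \<Rightarrow> ennreal" where
  "W11_sum \<Omega> f G = L1_norm \<Omega> f + (\<Sum>i\<in>UNIV. L1_norm \<Omega> (G i))"

lemma W11_norm_le: "(\<And>i. has_weak_partial \<Omega> i f (G i)) \<Longrightarrow> W11_norm \<Omega> f \<le> W11_sum \<Omega> f G"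
  unfolding W11_norm_def W11_sum_def by (intro Inf_lower) auto

lemma W11_sum_add: "W11_sum \<Omega> (\<lambda>x. f x + g x) (\<lambda>i x. F i x + G i x) \<le> W11_sum \<Omega> f F + W11_sum \<Omega> g G"
proof -
  have "W11_sum \<Omega> (\<lambda>x. f x + g x) (\<lambda>i x. F i x + G i x)
      \<le> (L1_norm \<Omega> f + L1_norm \<Omega> g) + (\<Sum>i\<in>UNIV. L1_norm \<Omega> (F i) + L1_norm \<Omega> (G i))"
    unfolding W11_sum_def by (intro add_mono sum_mono L1_norm_add)
  then show ?thesis by (simp add: W11_sum_def sum.distrib ac_simps)
qed

lemma L1_norm_continuous_in_time:
  fixes f :: "real \<Rightarrow> real ^ 'n::finite \<Rightarrow> 'b::euclidean_space"
  assumes f: "continuous_on ({0<..} \<times> UNIV) (\<lambda>(t, x). f t x)" and t: "t > 0"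
  shows "((\<lambda>s. L1_norm (ball a r) (\<lambda>x. f s x - f t x)) \<longlongrightarrow> 0) (nhds t)"
proof (rule order_tendstoI)
  fix \<epsilon> :: ennreal assume "0 < \<epsilon>"
  then obtain z where z: "0 < z" "z < \<epsilon>" using dense by blast
  then obtain e where e: "z = ennreal e" "e > 0" by (cases z) auto
  define V where "V = measure lebesgue (ball a r)"
  have Vb: "emeasure lebesgue (ball a r) = ennreal V"
    using emeasure_bounded_finite[of "ball a r"]
    by (simp add: V_def emeasure_eq_ennreal_measure less_top)
  define e' where "e' = e / (V + 1)"
  have V: "V \<ge> 0" by (simp add: V_def)
  have e': "e' > 0" using e V by (simp add: e'_def)
  let ?K = "{t/2..2*t} \<times> cball a r"
  have "uniformly_continuous_on ?K (\<lambda>(t, x). f t x)"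
    using f t by (intro compact_uniformly_continuous compact_Times)
      (auto elim!: continuous_on_subset)
  then obtain d where d: "d > 0"
      "\<And>p q. p \<in> ?K \<Longrightarrow> q \<in> ?K \<Longrightarrow> dist q p < d \<Longrightarrow> dist (case q of (t, x) \<Rightarrow> f t x) (case p of (t, x) \<Rightarrow> f t x) < e'"
    using e' unfolding uniformly_continuous_on_def by metis
  have "eventually (\<lambda>s. s \<in> {t/2<..<2*t} \<and> dist s t < d) (nhds t)"
    using t d(1) by (intro eventually_conj eventually_nhds_in_open)
      (auto simp: eventually_nhds_metric)
  then show "eventually (\<lambda>s. L1_norm (ball a r) (\<lambda>x. f s x - f t x) < \<epsilon>) (nhds t)"
  proof eventually_elim
    case (elim s)
    have s: "s > 0" using elim t by auto
    have c: "continuous_on UNIV (f s)" if "s > 0" for s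
      using continuous_on_compose2[OF f, of UNIV "\<lambda>x. (s, x)"] that by (simp add: continuous_on_Pair image_subset_iff)
    have m: "(\<lambda>x. f s x - f t x) \<in> borel_measurable (lebesgue_on (ball a r))"
      using c s t by (intro measurable_restrict_space1 measurable_completion)
        (auto intro!: borel_measurable_continuous_onI continuous_intros)
    have "(\<integral>\<^sup>+x. ennreal (norm (f s x - f t x)) \<partial>lebesgue_on (ball a r))
        \<le> (\<integral>\<^sup>+x. ennreal e' \<partial>lebesgue_on (ball a r))"
    proof (intro nn_integral_mono)
      fix x assume "x \<in> space (lebesgue_on (ball a r))"
      then have "dist (f s x) (f t x) < e'"
        using d(2)[of "(t, x)" "(s, x)"] elim t by (auto simp: dist_Pair_Pair)
      then show "ennreal (norm (f s x - f t x)) \<le> ennreal e'"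
        by (intro ennreal_leI) (simp add: dist_norm)
    qed
    also have "\<dots> = ennreal (e' * V)"
      using e' V Vb by (simp add: emeasure_restrict_space ennreal_mult)
    also have "\<dots> \<le> ennreal e"
      using e V by (intro ennreal_leI) (simp add: e'_def field_simps)
    also have "\<dots> < \<epsilon>" using z e by simp
    finally show ?case using m by (simp add: L1_norm_def)
  qed
qed simp

text \<open>The Sobolev norm is an infimum, hence upper semicontinuous along a curve that is continuous
  together with its first derivatives; this gives measurability without uniqueness of weak
  derivatives.\<close>

lemma W11_norm_measurable_in_time:
  fixes b :: "real \<Rightarrow> real ^ 'n::finite \<Rightarrow> 'b::euclidean_space"
  assumes C1: "\<And>t. t > 0 \<Longrightarrow> C1_with (b t) (b' t)"
    and b: "continuous_on ({0<..} \<times> UNIV) (\<lambda>(t, x). b t x)"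
    and b': "\<And>v. continuous_on ({0<..} \<times> UNIV) (\<lambda>(t, x). b' t x v)"
  shows "(\<lambda>t. W11_norm (ball a r) (b t)) \<in> borel_measurable (lebesgue_on {0<..<T})"
proof (rule borel_measurableI_less)
  fix c :: ennreal
  let ?N = "\<lambda>t. W11_norm (ball a r) (b t)"
  have "eventually (\<lambda>s. s \<in> {t \<in> {0<..<T}. ?N t < c}) (nhds t)" if t: "t \<in> {0<..<T}" "?N t < c" for t
  proof -
    obtain G where G: "\<And>i. has_weak_partial (ball a r) i (b t) (G i)" "W11_sum (ball a r) (b t) G < c"
      using t(2) unfolding W11_norm_def Inf_less_iff W11_sum_def by blast
    \<comment> \<open>weak derivatives of \<open>b t\<close> close to the infimum, plus the classical ones of \<open>b s - b t\<close>,
      compete in the infimum for \<open>b s\<close>\<close>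
    let ?e = "\<lambda>s. W11_sum (ball a r) (\<lambda>x. b s x - b t x) (\<lambda>i x. b' s x (axis i 1) - b' t x (axis i 1))"
    have "(?e \<longlongrightarrow> 0 + (\<Sum>i\<in>(UNIV :: 'n set). 0)) (nhds t)"
      unfolding W11_sum_def using t b b'
      by (intro tendsto_add tendsto_sum L1_norm_continuous_in_time) auto
    then have "((\<lambda>s. W11_sum (ball a r) (b t) G + ?e s) \<longlongrightarrow> W11_sum (ball a r) (b t) G + 0) (nhds t)"
      by (intro tendsto_add) auto
    then have "eventually (\<lambda>s. W11_sum (ball a r) (b t) G + ?e s < c) (nhds t)"
      using G(2) by (intro order_tendstoD(2)) auto
    moreover have "eventually (\<lambda>s. s \<in> {0<..<T}) (nhds t)"
      using t by (intro eventually_nhds_in_open) auto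
    ultimately show ?thesis
    proof eventually_elim
      case (elim s)
      have "C1_with (\<lambda>x. b s x - b t x) (\<lambda>x v. b' s x v - b' t x v)"
        using C1[of s] C1[of t] elim t unfolding C1_with_def
        by (auto intro!: has_derivative_diff continuous_intros)
      from has_weak_partial_add[OF G(1) has_weak_partial_C1[OF this]]
      have "has_weak_partial (ball a r) i (b s) (\<lambda>x. G i x + (b' s x (axis i 1) - b' t x (axis i 1)))" for i
        by simp
      from W11_norm_le[of "ball a r" "b s", OF this]
      have "?N s \<le> W11_sum (ball a r) (\<lambda>x. b t x + (b s x - b t x)) (\<lambda>i x. G i x + (b' s x (axis i 1) - b' t x (axis i 1)))"
        by simp
      also have "\<dots> \<le> W11_sum (ball a r) (b t) G + ?e s" by (rule W11_sum_add)
      finally show ?case using elim by auto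
    qed
  qed
  note near = this
  have "open {t \<in> {0<..<T}. ?N t < c}"
    unfolding open_subopen[of "{t \<in> {0<..<T}. ?N t < c}"]
  proof
    fix t assume "t \<in> {t \<in> {0<..<T}. ?N t < c}"
    then have "eventually (\<lambda>s. s \<in> {t \<in> {0<..<T}. ?N t < c}) (nhds t)" by (intro near) auto
    then obtain U where "open U" "t \<in> U" "\<forall>s\<in>U. s \<in> {t \<in> {0<..<T}. ?N t < c}"
      unfolding eventually_nhds by blast
    then show "\<exists>U. open U \<and> t \<in> U \<and> U \<subseteq> {t \<in> {0<..<T}. ?N t < c}"
      by (intro exI[of _ U] conjI subsetI) simp_all
  qed
  then have "{t \<in> {0<..<T}. ?N t < c} \<in> sets lebesgue"
    by (intro sets_completionI_sets) simp
  then show "{t \<in> space (lebesgue_on {0<..<T}). ?N t < c} \<in> sets (lebesgue_on {0<..<T})"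
    by (subst sets_restrict_space_iff) auto
qed

section \<open>The Orlicz norm under dilations\<close>

lemma log_plus_ge_1: "log_plus t \<ge> 1" by (simp add: log_plus_def)

lemma orlicz_P_0 [simp]: "orlicz_P \<gamma> 0 = 0" by (simp add: orlicz_P_def)

lemma borel_measurable_orlicz_P [measurable]: "orlicz_P \<gamma> \<in> borel_measurable borel"
  unfolding orlicz_P_def[abs_def] log_plus_def[abs_def] by measurable

text \<open>The function \<open>s / log_plus s powr \<gamma>\<close> is not monotone. The bound holds nevertheless: for \<open>s \<le> L\<close>
  because the denominator is at least 1, and for \<open>s > L\<close> because the denominator is then at least
  \<open>log_plus L powr \<gamma>\<close>.\<close>

lemma orlicz_P_le:
  assumes "\<gamma> \<ge> 0" "L \<ge> 0" "0 \<le> s" "s \<le> L * log_plus L powr \<gamma>"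
  shows "orlicz_P \<gamma> s \<le> exp L - 1"
proof -
  have p: "log_plus s powr \<gamma> \<ge> 1" for s
    using log_plus_ge_1[of s] assms(1) by (rule ge_one_powr_ge_zero)
  have "s / log_plus s powr \<gamma> \<le> L"
  proof (cases "s \<le> L")
    case True
    have "s / log_plus s powr \<gamma> \<le> s / 1"
      using p[of s] assms by (intro divide_left_mono) auto
    then show ?thesis using True by simp
  next
    case False
    have "log_plus L \<le> log_plus s"
    proof (cases "L = 0")
      case True then show ?thesis using log_plus_ge_1[of s] by (simp add: log_plus_def)
    next
      case False
      then have "ln L \<le> ln s" using \<open>\<not> s \<le> L\<close> assms by simp
      then show ?thesis by (simp add: log_plus_def max_def)
    qed
    then have "log_plus L powr \<gamma> \<le> log_plus s powr \<gamma>"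
      using assms log_plus_ge_1[of L] by (intro powr_mono2) auto
    then have "s \<le> L * log_plus s powr \<gamma>"
      using assms by (meson mult_left_mono order_trans)
    then show ?thesis using p[of s] by (subst pos_divide_le_eq) auto
  qed
  then show ?thesis by (simp add: orlicz_P_def)
qed

lemma Exp_norm_cmult:
  fixes f :: "real ^ 'n::finite \<Rightarrow> real"
  assumes c: "c > 0"
  shows "Exp_norm \<gamma> (\<lambda>x. c * f x) = ennreal c * Exp_norm \<gamma> f"
proof -
  have le: "Exp_norm \<gamma> (\<lambda>x. c * f x) \<le> ennreal c * Exp_norm \<gamma> f"
    if c: "c > 0" for c and f :: "real ^ 'n \<Rightarrow> real"
  proof (cases "f \<in> borel_measurable lebesgue")
    case True
    have inv: "ennreal (1 / c) * ennreal c = 1" using c by (simp flip: ennreal_mult)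
    have "ennreal (1 / c) * Exp_norm \<gamma> (\<lambda>x. c * f x) \<le> Exp_norm \<gamma> f"
      unfolding Exp_norm_def[of \<gamma> f] if_P[OF True]
    proof (rule Inf_greatest, clarify)
      fix l :: real assume l: "l > 0" "(\<integral>\<^sup>+x. ennreal (orlicz_P \<gamma> (\<bar>f x\<bar> / l)) \<partial>lebesgue) \<le> 1"
      have "Exp_norm \<gamma> (\<lambda>x. c * f x) \<le> ennreal (c * l)"
        unfolding Exp_norm_def using True l c
        by (auto intro!: Inf_lower exI[of _ "c * l"] simp: abs_mult)
      then have "ennreal (1 / c) * Exp_norm \<gamma> (\<lambda>x. c * f x) \<le> ennreal (1 / c) * ennreal (c * l)"
        by (rule mult_left_mono) simp
      also have "\<dots> = ennreal l" using c l by (simp flip: ennreal_mult)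
      finally show "ennreal (1 / c) * Exp_norm \<gamma> (\<lambda>x. c * f x) \<le> ennreal l" .
    qed
    then have "ennreal c * (ennreal (1 / c) * Exp_norm \<gamma> (\<lambda>x. c * f x)) \<le> ennreal c * Exp_norm \<gamma> f"
      by (rule mult_left_mono) simp
    then show ?thesis using inv by (simp add: mult.assoc[symmetric] mult.commute[of "ennreal c"])
  qed (use c in \<open>simp add: Exp_norm_def ennreal_mult_top\<close>)
  have "Exp_norm \<gamma> f = Exp_norm \<gamma> (\<lambda>x. (1 / c) * (c * f x))" using c by simp
  also have "\<dots> \<le> ennreal (1 / c) * Exp_norm \<gamma> (\<lambda>x. c * f x)" using c by (intro le) simp
  finally have "ennreal c * Exp_norm \<gamma> f \<le> ennreal c * (ennreal (1 / c) * Exp_norm \<gamma> (\<lambda>x. c * f x))"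
    by (rule mult_left_mono) simp
  also have "\<dots> = Exp_norm \<gamma> (\<lambda>x. c * f x)"
    using c by (simp add: mult.assoc[symmetric] flip: ennreal_mult)
  finally show ?thesis using le[OF c, of f] by (intro antisym)
qed

lemma nn_integral_orlicz_P_dilate:
  fixes f :: "real ^ 'n::finite \<Rightarrow> real"
  assumes [measurable]: "f \<in> borel_measurable lebesgue" and t: "t > 0"
  shows "(\<integral>\<^sup>+x. ennreal (orlicz_P \<gamma> (\<bar>f (x /\<^sub>R t)\<bar> / l)) \<partial>lebesgue)
     = ennreal (t ^ CARD('n)) * (\<integral>\<^sup>+x. ennreal (orlicz_P \<gamma> (\<bar>f x\<bar> / l)) \<partial>lebesgue)"
proof -
  have "(\<lambda>x. ennreal (orlicz_P \<gamma> (\<bar>f x\<bar> / l))) \<in> borel_measurable lebesgue" by measurable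
  from nn_integral_dilate[OF this t] show ?thesis by simp
qed

text \<open>Dilating \<open>f\<close> by \<open>t\<close> multiplies every modular \<open>\<integral> P(\<bar>f\<bar>/l)\<close> by \<open>t\<close> to the power of the dimension.\<close>

lemma Exp_norm_dilate_mono:
  fixes f :: "real ^ 'n::finite \<Rightarrow> real"
  assumes f: "f \<in> borel_measurable lebesgue" and "0 < s" "s \<le> t"
  shows "Exp_norm \<gamma> (\<lambda>x. f (x /\<^sub>R s)) \<le> Exp_norm \<gamma> (\<lambda>x. f (x /\<^sub>R t))"
proof -
  have "ennreal (s ^ CARD('n)) \<le> ennreal (t ^ CARD('n))"
    using assms by (intro ennreal_leI power_mono) auto
  then have *: "ennreal (s ^ CARD('n)) * a \<le> ennreal (t ^ CARD('n)) * a" for a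
    by (rule mult_right_mono) simp
  show ?thesis
    using assms measurable_dilate[OF f, of s] measurable_dilate[OF f, of t]
    unfolding Exp_norm_def
    by (auto intro!: Inf_superset_mono simp: nn_integral_orlicz_P_dilate[OF f] intro: order_trans[OF *])
qed

text \<open>The norm of \<open>(1/t) f(x/t)\<close> is a product of a continuous and a monotone function of \<open>t\<close>.\<close>

lemma Exp_norm_dilate_measurable:
  fixes f :: "real ^ 'n::finite \<Rightarrow> real"
  assumes f: "f \<in> borel_measurable lebesgue"
  shows "(\<lambda>t. Exp_norm \<gamma> (\<lambda>x. (1 / t) * f (x /\<^sub>R t))) \<in> borel_measurable (lebesgue_on {0<..<T})"
proof -
  have [measurable]: "(\<lambda>t. Exp_norm \<gamma> (\<lambda>x. f (x /\<^sub>R t))) \<in> borel_measurable (lebesgue_on {0<..<T})"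
    by (intro borel_measurable_mono_on_Ioo monotone_onI Exp_norm_dilate_mono[OF f]) auto
  have [measurable]: "(\<lambda>t::real. t) \<in> borel_measurable (lebesgue_on {0<..<T})"
    by (intro measurable_restrict_space1 measurable_completion) simp
  have "(\<lambda>t. ennreal (1 / t) * Exp_norm \<gamma> (\<lambda>x. f (x /\<^sub>R t))) \<in> borel_measurable (lebesgue_on {0<..<T})"
    by measurable
  then show ?thesis
    by (rule measurable_cong[THEN iffD1, rotated]) (subst Exp_norm_cmult; simp)
qed

text \<open>\<open>L\<close> is chosen so that \<open>exp L - 1\<close> is the reciprocal of \<open>V t\<^sup>n\<close>, a bound for the measure of the
  dilated support. For the stated level the modular is then at most 1.\<close>

lemma Exp_norm_dilate_le:
  fixes f :: "real ^ 'n::finite \<Rightarrow> real"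
  assumes f: "f \<in> borel_measurable lebesgue" and C: "C > 0" "\<And>x. \<bar>f x\<bar> \<le> C"
    and supp: "\<And>x. x \<notin> K \<Longrightarrow> f x = 0" and K: "K \<in> sets lebesgue" "emeasure lebesgue K \<le> ennreal V" "V > 0"
    and t: "t > 0" and \<gamma>: "\<gamma> \<ge> 0"
  defines "L \<equiv> ln (1 + 1 / (V * t ^ CARD('n)))"
  shows "Exp_norm \<gamma> (\<lambda>x. (1 / t) * f (x /\<^sub>R t)) \<le> ennreal (C / (t * (L * log_plus L powr \<gamma>)))"
proof -
  have a: "1 / (V * t ^ CARD('n)) > 0" using K t by simp
  then have L: "L > 0" "exp L = 1 + 1 / (V * t ^ CARD('n))"
    unfolding L_def by (intro ln_gt_zero, simp, intro exp_ln, linarith)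
  have p: "L * log_plus L powr \<gamma> > 0" using L log_plus_ge_1[of L] by simp
  \<comment> \<open>an upper bound for the norm of the dilate without the factor \<open>1 / t\<close>\<close>
  define l where "l = C / (L * log_plus L powr \<gamma>)"
  have l: "l > 0" using p C by (simp add: l_def)
  have "orlicz_P \<gamma> (\<bar>f x\<bar> / l) \<le> 1 / (V * t ^ CARD('n)) * indicator K x" for x
  proof (cases "x \<in> K")
    case True
    have "\<bar>f x\<bar> * (L * log_plus L powr \<gamma>) \<le> C * (L * log_plus L powr \<gamma>)"
      using C p by (intro mult_right_mono) auto
    then have "\<bar>f x\<bar> / l \<le> L * log_plus L powr \<gamma>"
      using C(1) by (simp add: l_def divide_le_eq mult.commute)
    then have "orlicz_P \<gamma> (\<bar>f x\<bar> / l) \<le> exp L - 1"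
      using \<gamma> L l by (intro orlicz_P_le) auto
    then show ?thesis using True L by simp
  qed (simp add: supp)
  then have "ennreal (orlicz_P \<gamma> (\<bar>f x\<bar> / l)) \<le> ennreal (1 / (V * t ^ CARD('n)) * indicator K x)" for x
    by (rule ennreal_leI)
  moreover have "ennreal (1 / (V * t ^ CARD('n)) * indicator K x) = ennreal (1 / (V * t ^ CARD('n))) * indicator K x" for x
    by (simp add: indicator_def)
  ultimately have "(\<integral>\<^sup>+x. ennreal (orlicz_P \<gamma> (\<bar>f x\<bar> / l)) \<partial>lebesgue)
      \<le> (\<integral>\<^sup>+x. ennreal (1 / (V * t ^ CARD('n))) * indicator K x \<partial>lebesgue)"
    by (intro nn_integral_mono) simp
  also have "\<dots> = ennreal (1 / (V * t ^ CARD('n))) * emeasure lebesgue K"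
    using K by (simp add: nn_integral_cmult_indicator)
  also have "\<dots> \<le> ennreal (1 / (V * t ^ CARD('n))) * ennreal V"
    by (rule mult_left_mono[OF K(2)]) simp
  finally have "ennreal (t ^ CARD('n)) * (\<integral>\<^sup>+x. ennreal (orlicz_P \<gamma> (\<bar>f x\<bar> / l)) \<partial>lebesgue)
      \<le> ennreal (t ^ CARD('n)) * (ennreal (1 / (V * t ^ CARD('n))) * ennreal V)"
    by (rule mult_left_mono) simp
  also have "\<dots> = 1" using K t by (simp flip: ennreal_mult)
  finally have "Exp_norm \<gamma> (\<lambda>x. f (x /\<^sub>R t)) \<le> ennreal l"
    using l measurable_dilate[OF f t] unfolding Exp_norm_def
    by (auto intro!: Inf_lower simp: nn_integral_orlicz_P_dilate[OF f t])
  then have "ennreal (1 / t) * Exp_norm \<gamma> (\<lambda>x. f (x /\<^sub>R t)) \<le> ennreal (1 / t) * ennreal l"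
    by (rule mult_left_mono) simp
  also have "\<dots> = ennreal (C / (t * (L * log_plus L powr \<gamma>)))"
    using t l by (simp add: l_def flip: ennreal_mult)
  finally show ?thesis using t by (subst Exp_norm_cmult) auto
qed

section \<open>The borderline integral in time\<close>

text \<open>A primitive of the integrand is a multiple of \<open>ln (- ln t / 2) powr (1 - \<gamma>)\<close>, which tends to 0 at
  the origin precisely because \<open>\<gamma> > 1\<close>.\<close>

lemma log_log_integral_finite:
  assumes \<gamma>: "\<gamma> > 1"
  shows "set_integrable lborel {0<..<exp (-4)} (\<lambda>t::real. 1 / (t * (- ln t / 2) * ln (- ln t / 2) powr \<gamma>))"
proof -
  let ?w = "\<lambda>t::real. - ln t / 2"
  let ?F = "\<lambda>t. (2 / (\<gamma> - 1)) * ln (?w t) powr (1 - \<gamma>)"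
  let ?f = "\<lambda>t. 1 / (t * ?w t * ln (?w t) powr \<gamma>)"
  have w: "?w t > 2" if "0 < t" "t < exp (-4)" for t
    using that ln_less_cancel_iff[of t "exp (-4)"] by simp
  have lw: "ln (?w t) > 0" if "0 < t" "t < exp (-4)" for t
    using w[OF that] by (intro ln_gt_zero) simp
  have "set_integrable lborel (einterval (ereal 0) (ereal (exp (-4)))) ?f"
  proof (rule interval_integral_FTC_nonneg(1)[where F = ?F])
    show "ereal 0 < ereal (exp (-4))" by simp
    fix t assume t': "ereal 0 < ereal t" "ereal t < ereal (exp (-4))"
    then have t: "0 < t" "t < exp (-4)" by auto
    have t1: "t < 1" using t(2) by (rule less_trans) simp
    have d: "((\<lambda>t. ln (?w t)) has_real_derivative (1 / ?w t * (- (1 / t) / 2))) (at t)"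
      using t t1 w[OF t] by (auto intro!: derivative_eq_intros)
    have "((\<lambda>t. ln (?w t) powr (1 - \<gamma>)) has_real_derivative
        ((1 - \<gamma>) * ln (?w t) powr (1 - \<gamma> - 1) * (1 / ?w t * (- (1 / t) / 2)))) (at t)"
      using DERIV_fun_powr[OF d lw[OF t], of "1 - \<gamma>"] by simp
    from DERIV_cmult[OF this, of "2 / (\<gamma> - 1)"]
    show "(?F has_real_derivative ?f t) (at t)"
    proof (rule DERIV_cong)
      have "(2 / (\<gamma> - 1)) * ((1 - \<gamma>) * p * (1 / w * (- (1 / t) / 2))) = p / (t * w)" if "w > 0" for p w :: real
        using that t \<gamma> by (simp add: field_simps)
      from this[of "?w t" "ln (?w t) powr (1 - \<gamma> - 1)"] w[OF t]
      show "(2 / (\<gamma> - 1)) * ((1 - \<gamma>) * ln (?w t) powr (1 - \<gamma> - 1) * (1 / ?w t * (- (1 / t) / 2))) = ?f t"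
        by (simp add: powr_minus_divide)
    qed
    show "isCont ?f t" using t w[OF t] lw[OF t] by (intro continuous_intros) auto
  next
    have "0 \<le> ?f t" if "0 < t" "t < exp (-4)" for t
      using w[OF that] that less_trans[of t "exp (-4)" 1]
      by (intro divide_nonneg_nonneg mult_nonneg_nonneg) auto
    then show "AE t in lborel. ereal 0 < ereal t \<longrightarrow> ereal t < ereal (exp (-4)) \<longrightarrow> 0 \<le> ?f t"
      by (intro AE_I2 impI) auto
    have "filterlim (\<lambda>t. ln (?w t)) at_top (at_right 0)" by real_asymp
    then have "((\<lambda>t. ln (?w t) powr (1 - \<gamma>)) \<longlongrightarrow> 0) (at_right 0)"
      using \<gamma> by (intro tendsto_neg_powr) auto
    then have "(?F \<longlongrightarrow> 2 / (\<gamma> - 1) * 0) (at_right 0)" by (rule tendsto_mult_left)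
    then show "((?F \<circ> real_of_ereal) \<longlongrightarrow> 2 / (\<gamma> - 1) * 0) (at_right (ereal 0))"
      by (simp only: ereal_tendsto_simps)
    have "isCont ?F (exp (-4))" by (intro continuous_intros) auto
    then have "(?F \<longlongrightarrow> ?F (exp (-4))) (at_left (exp (-4)))"
      by (simp add: isCont_def filterlim_at_split)
    then show "((?F \<circ> real_of_ereal) \<longlongrightarrow> ?F (exp (-4))) (at_left (ereal (exp (-4))))"
      by (simp only: ereal_tendsto_simps)
  qed
  then show ?thesis by simp
qed

text \<open>Near 0, \<open>L t\<close> exceeds \<open>- ln t / 2\<close> and the integrand is dominated by the previous one; away from
  0 it is bounded.\<close>

lemma critical_integral_finite:
  fixes V C T \<gamma> :: real and n :: nat
  assumes \<gamma>: "\<gamma> > 1" and V: "V > 0" and C: "C > 0" and n: "n \<ge> 1" and T: "T > 0"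
  defines "L \<equiv> \<lambda>t. ln (1 + 1 / (V * t ^ n))"
  shows "(\<integral>\<^sup>+t. ennreal (C / (t * (L t * log_plus (L t) powr \<gamma>))) \<partial>lebesgue_on {0<..<T}) < \<infinity>"
proof -
  define f where "f t = 1 / (t * (- ln t / 2) * ln (- ln t / 2) powr \<gamma>)" for t :: real
  \<comment> \<open>the logarithmic comparison applies below \<open>\<tau>\<close>: \<open>exp (-4)\<close> makes the iterated logarithm positive,
    \<open>1 / V\<^sup>2\<close> gives \<open>V t \<le> sqrt t\<close>\<close>
  define \<tau> where "\<tau> = min T (min (exp (-4)) (1 / V\<^sup>2))"
  have \<tau>: "\<tau> > 0" "\<tau> \<le> T" using T V by (auto simp: \<tau>_def)
  have LT: "L T > 0" using V T unfolding L_def by (intro ln_gt_zero) simp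
  have powr1: "log_plus x powr \<gamma> \<ge> 1" for x
    using log_plus_ge_1[of x] \<gamma> by (intro ge_one_powr_ge_zero) auto
  have large: "C / (t * (L t * log_plus (L t) powr \<gamma>)) \<le> C / (\<tau> * L T)" if t: "\<tau> \<le> t" "t < T" for t
  proof -
    have t0: "t > 0" using t \<tau> by simp
    then have "V * t ^ n \<le> V * T ^ n" using V t by (intro mult_left_mono power_mono) auto
    then have "1 / (V * T ^ n) \<le> 1 / (V * t ^ n)"
      using V t0 T by (intro divide_left_mono) auto
    then have "L T \<le> L t" using V T t0 unfolding L_def by (subst ln_le_cancel_iff) (auto intro: add_pos_pos)
    then have "L T * 1 \<le> L t * log_plus (L t) powr \<gamma>"
      using LT powr1[of "L t"] by (intro mult_mono) auto
    then have le: "\<tau> * L T \<le> t * (L t * log_plus (L t) powr \<gamma>)"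
      using t \<tau> LT by (intro mult_mono) auto
    have pos: "\<tau> * L T > 0" using \<tau> LT by simp
    show ?thesis
      using divide_left_mono[OF le less_imp_le[OF C] mult_pos_pos[OF order_less_le_trans[OF pos le] pos]] .
  qed
  have small: "C / (t * (L t * log_plus (L t) powr \<gamma>)) \<le> C * f t" "f t \<ge> 0" "t \<in> {0<..<exp (-4)}"
    if t: "0 < t" "t < \<tau>" for t
  proof -
    let ?w = "- ln t / 2"
    have t': "t < exp (-4)" "t < 1 / V\<^sup>2" using t by (auto simp: \<tau>_def)
    have "t < 1" using t'(1) by (rule less_trans) simp
    have w: "?w > 2" using t t' ln_less_cancel_iff[of t "exp (-4)"] by simp
    have lw: "ln ?w > 0" using w by (intro ln_gt_zero) simp
    have "V * sqrt t \<le> 1"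
    proof -
      have "(V * sqrt t)\<^sup>2 \<le> 1\<^sup>2" using t'(2) t V by (simp add: power_mult_distrib field_simps)
      then show ?thesis by (rule power2_le_imp_le) simp
    qed
    then have "V * sqrt t * sqrt t \<le> 1 * sqrt t" using t by (intro mult_right_mono) auto
    then have "V * t \<le> sqrt t" using t by (simp add: mult.assoc)
    moreover have "t ^ n \<le> t ^ 1" using t \<open>t < 1\<close> n by (intro power_decreasing) auto
    then have "V * t ^ n \<le> V * t" using V by simp
    ultimately have "V * t ^ n \<le> sqrt t" by simp
    then have "1 / sqrt t \<le> 1 / (V * t ^ n)" using V t by (intro divide_left_mono) auto
    then have "1 / sqrt t \<le> 1 + 1 / (V * t ^ n)" by simp
    then have "ln (1 / sqrt t) \<le> L t" using t V unfolding L_def by (subst ln_le_cancel_iff) (auto intro: add_pos_pos)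
    moreover have "ln (1 / sqrt t) = ?w" using t by (simp add: ln_div ln_sqrt)
    ultimately have L: "?w \<le> L t" by simp
    then have "ln ?w \<le> ln (L t)" using w by (subst ln_le_cancel_iff) auto
    then have "ln ?w \<le> log_plus (L t)" by (simp add: log_plus_def)
    then have "ln ?w powr \<gamma> \<le> log_plus (L t) powr \<gamma>" using \<gamma> lw by (intro powr_mono2) auto
    then have "?w * ln ?w powr \<gamma> \<le> L t * log_plus (L t) powr \<gamma>"
      using L w by (intro mult_mono) auto
    then have le: "t * (?w * ln ?w powr \<gamma>) \<le> t * (L t * log_plus (L t) powr \<gamma>)"
      using t by (intro mult_left_mono) auto
    have pos: "t * (?w * ln ?w powr \<gamma>) > 0" using t w lw \<open>t < 1\<close> by (intro mult_pos_pos) auto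
    have "C / (t * (L t * log_plus (L t) powr \<gamma>)) \<le> C / (t * (?w * ln ?w powr \<gamma>))"
      using divide_left_mono[OF le less_imp_le[OF C] mult_pos_pos[OF order_less_le_trans[OF pos le] pos]] .
    then show "C / (t * (L t * log_plus (L t) powr \<gamma>)) \<le> C * f t"
      by (simp add: f_def mult.assoc)
    show "f t \<ge> 0" using pos by (simp add: f_def mult.assoc)
    show "t \<in> {0<..<exp (-4)}" using t t' by simp
  qed
  let ?g = "\<lambda>t. ennreal (C * norm (indicator {0<..<exp (-4)} t *\<^sub>R f t)) + ennreal (C / (\<tau> * L T)) * indicator {0<..<T} t"
  have le: "ennreal (C / (t * (L t * log_plus (L t) powr \<gamma>))) * indicator {0<..<T} t \<le> ?g t" for t
  proof (cases "t \<in> {0<..<T}")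
    case t: True
    show ?thesis
    proof (cases "t < \<tau>")
      case True
      then have "ennreal (C / (t * (L t * log_plus (L t) powr \<gamma>))) \<le> ennreal (C * norm (indicator {0<..<exp (-4)} t *\<^sub>R f t))"
        using small[of t] t by (intro ennreal_leI) auto
      then show ?thesis using t by (auto intro: order_trans)
    next
      case False
      then have "ennreal (C / (t * (L t * log_plus (L t) powr \<gamma>))) \<le> ennreal (C / (\<tau> * L T))"
        using large[of t] t by (intro ennreal_leI) auto
      then show ?thesis using t by (auto intro: order_trans)
    qed
  qed auto
  have i: "integrable lborel (\<lambda>t. indicator {0<..<exp (-4)} t *\<^sub>R f t)"
    using log_log_integral_finite[OF \<gamma>] by (simp add: set_integrable_def f_def[abs_def])
  have [measurable]: "f \<in> borel_measurable borel" unfolding f_def[abs_def] by measurable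
  have "(\<integral>\<^sup>+t. ennreal (C / (t * (L t * log_plus (L t) powr \<gamma>))) \<partial>lebesgue_on {0<..<T})
      = (\<integral>\<^sup>+t. ennreal (C / (t * (L t * log_plus (L t) powr \<gamma>))) * indicator {0<..<T} t \<partial>lebesgue)"
    by (subst nn_integral_restrict_space) auto
  also have "\<dots> \<le> (\<integral>\<^sup>+t. ?g t \<partial>lebesgue)" by (intro nn_integral_mono le)
  also have "\<dots> = (\<integral>\<^sup>+t. ?g t \<partial>lborel)" by (simp only: nn_integral_completion)
  also have "\<dots> = ennreal C * (\<integral>\<^sup>+t. ennreal (norm (indicator {0<..<exp (-4)} t *\<^sub>R f t)) \<partial>lborel)
      + ennreal (C / (\<tau> * L T)) * ennreal T"
    using C T by (subst nn_integral_add)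
      (auto simp: ennreal_mult nn_integral_cmult nn_integral_cmult_indicator simp del: norm_scaleR real_scaleR_def)
  also have "\<dots> < \<infinity>"
    using i unfolding integrable_iff_bounded by (simp add: ennreal_mult_less_top ennreal_add_less_top)
  finally show ?thesis .
qed

section \<open>The vector field\<close>

text \<open>A continuously differentiable cutoff: it is 1 on \<open>(-\<infinity>, 1]\<close> and 0 on \<open>[2, \<infinity>)\<close>.\<close>

definition cutoff :: "real \<Rightarrow> real" where
  "cutoff s = (max 0 (1 - (max 0 (s - 1))\<^sup>2))\<^sup>2"

text \<open>The derivative of the cutoff.\<close>

definition cutoff' :: "real \<Rightarrow> real" where
  "cutoff' s = - 4 * max 0 (1 - (max 0 (s - 1))\<^sup>2) * max 0 (s - 1)"

lemma pos_part_square_derivative: "((\<lambda>x. (max 0 x)\<^sup>2) has_real_derivative 2 * max 0 x) (at (x::real))"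
proof -
  have "((\<lambda>h. norm ((max 0 (x + h))\<^sup>2 - (max 0 x)\<^sup>2 - 2 * max 0 x * h) / norm h) \<longlongrightarrow> 0) (at 0)"
  proof (rule Lim_null_comparison)
    have "\<bar>(max 0 (x + h))\<^sup>2 - (max 0 x)\<^sup>2 - 2 * max 0 x * h\<bar> \<le> h\<^sup>2" for h
    proof -
      consider "x \<ge> 0" "x + h \<ge> 0" | "x \<ge> 0" "x + h < 0" | "x < 0" "x + h \<ge> 0" | "x < 0" "x + h < 0" by linarith
      then show ?thesis
      proof cases
        case 1 then show ?thesis by (simp add: max_def power2_eq_square algebra_simps)
      next
        case 2
        have "(max 0 (x + h))\<^sup>2 - (max 0 x)\<^sup>2 - 2 * max 0 x * h = h\<^sup>2 - (x + h)\<^sup>2"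
          using 2 by (simp add: max_def power2_eq_square algebra_simps)
        moreover have "(x + h)\<^sup>2 \<le> h\<^sup>2" using 2 by (subst abs_le_square_iff[symmetric]) auto
        ultimately show ?thesis by simp
      next
        case 3
        then have "(x + h)\<^sup>2 \<le> h\<^sup>2" by (intro power_mono) auto
        then show ?thesis using 3 by (simp add: max_def)
      qed (simp add: max_def)
    qed
    then show "\<forall>\<^sub>F h in at 0. norm (norm ((max 0 (x + h))\<^sup>2 - (max 0 x)\<^sup>2 - 2 * max 0 x * h) / norm h) \<le> \<bar>h\<bar>"
      by (intro always_eventually) (auto simp: divide_le_eq power2_eq_square abs_mult_self_eq)
    show "((\<lambda>h::real. \<bar>h\<bar>) \<longlongrightarrow> 0) (at 0)" by (intro tendsto_rabs_zero tendsto_ident_at)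
  qed
  then show ?thesis
    by (simp add: has_field_derivative_def has_derivative_at bounded_linear_mult_right)
qed

lemma cutoff_derivative: "(cutoff has_real_derivative cutoff' s) (at s)"
proof -
  have 1: "((\<lambda>s. 1 - (max 0 (s - 1))\<^sup>2) has_real_derivative - (2 * max 0 (s - 1))) (at s)"
    using DERIV_diff[OF DERIV_const DERIV_chain2[where f = "\<lambda>x. (max 0 x)\<^sup>2" and g = "\<lambda>s. s - 1",
        OF pos_part_square_derivative DERIV_diff[OF DERIV_ident DERIV_const]]]
    by simp
  show ?thesis
    using DERIV_chain2[where f = "\<lambda>x. (max 0 x)\<^sup>2" and g = "\<lambda>s. 1 - (max 0 (s - 1))\<^sup>2",
        OF pos_part_square_derivative 1]
    unfolding cutoff_def[abs_def] cutoff'_def by (simp add: mult.assoc mult.commute mult.left_commute)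
qed

lemma continuous_cutoff: "continuous_on UNIV cutoff" "continuous_on UNIV cutoff'"
  unfolding cutoff_def[abs_def] cutoff'_def[abs_def] by (intro continuous_intros)+

lemma cutoff_1: "s \<le> 1 \<Longrightarrow> cutoff s = 1" "s \<le> 1 \<Longrightarrow> cutoff' s = 0"
  by (auto simp: cutoff_def cutoff'_def)

lemma cutoff_0:
  assumes "s \<ge> 2" shows "cutoff s = 0" "cutoff' s = 0"
proof -
  have "(s - 1)\<^sup>2 \<ge> 1\<^sup>2" using assms by (intro power_mono) auto
  then have "1 - (s - 1)\<^sup>2 \<le> 0" by simp
  then have "max 0 (1 - (max 0 (s - 1))\<^sup>2) = 0" using assms by (simp only: max_absorb1 max_absorb2)
  then show "cutoff s = 0" "cutoff' s = 0" by (simp_all add: cutoff_def cutoff'_def)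
qed

text \<open>The identity, cut off in a \<open>C\<^sup>1\<close> fashion outside the unit ball; it vanishes outside the ball of radius 2.\<close>

definition profile :: "'a::euclidean_space \<Rightarrow> 'a" where
  "profile y = cutoff (y \<bullet> y) *\<^sub>R y"

text \<open>The differential of the profile.\<close>

definition profile' :: "'a::euclidean_space \<Rightarrow> 'a \<Rightarrow> 'a" where
  "profile' y v = cutoff (y \<bullet> y) *\<^sub>R v + (cutoff' (y \<bullet> y) * (2 * (y \<bullet> v))) *\<^sub>R y"

lemma C1_profile: "C1_with profile profile'"
  unfolding C1_with_def
proof (intro allI conjI)
  fix y :: 'a
  have "((\<lambda>y. y \<bullet> y) has_derivative (\<lambda>v. 2 * (y \<bullet> v))) (at y)"
    by (auto intro!: derivative_eq_intros simp: inner_commute)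
  from has_derivative_compose[OF this cutoff_derivative[unfolded has_field_derivative_def]]
  have "((\<lambda>y. cutoff (y \<bullet> y)) has_derivative (\<lambda>v. cutoff' (y \<bullet> y) * (2 * (y \<bullet> v)))) (at y)" .
  from has_derivative_scaleR[OF this has_derivative_ident]
  show "(profile has_derivative profile' y) (at y)"
    by (simp add: profile_def[abs_def] profile'_def[abs_def])
next
  fix v :: 'a
  have "continuous_on UNIV (\<lambda>y::'a. cutoff (y \<bullet> y))" "continuous_on UNIV (\<lambda>y::'a. cutoff' (y \<bullet> y))"
    by (rule continuous_on_compose2[OF continuous_cutoff(1)] continuous_on_compose2[OF continuous_cutoff(2)];
        auto intro!: continuous_intros)+
  then show "continuous_on UNIV (\<lambda>y. profile' y v)"
    unfolding profile'_def by (intro continuous_intros)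
qed

lemma profile_inside:
  assumes "norm y \<le> 1" shows "profile y = y" "profile' y v = v"
proof -
  have "y \<bullet> y \<le> 1" using assms by (simp add: dot_square_norm power_le_one)
  then show "profile y = y" "profile' y v = v" by (simp_all add: profile_def profile'_def cutoff_1)
qed

lemma profile_outside:
  assumes "y \<notin> cball 0 2" shows "profile y = 0" "profile' y v = 0"
proof -
  have "2\<^sup>2 \<le> (norm y)\<^sup>2" using assms by (intro power_mono) auto
  then have "y \<bullet> y \<ge> 2" by (simp add: dot_square_norm)
  then show "profile y = 0" "profile' y v = 0" by (simp_all add: profile_def profile'_def cutoff_0)
qed

text \<open>The field is a dilation of the profile; at time \<open>t\<close> it equals \<open>x / t\<close> on the ball of radius \<open>t\<close>.\<close>

definition flow_field :: "real \<Rightarrow> real ^ 'n::finite \<Rightarrow> real ^ 'n" where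
  "flow_field t x = profile (x /\<^sub>R t)"

text \<open>The differential of the vector field in the space variable.\<close>

definition flow_field' :: "real \<Rightarrow> real ^ 'n::finite \<Rightarrow> real ^ 'n \<Rightarrow> real ^ 'n" where
  "flow_field' t x v = (1 / t) *\<^sub>R profile' (x /\<^sub>R t) v"

text \<open>The divergence of the profile.\<close>

definition profile_div :: "real ^ 'n::finite \<Rightarrow> real" where
  "profile_div y = (\<Sum>i\<in>UNIV. profile' y (axis i 1) $ i)"

lemma C1_field: "C1_with (flow_field t) (flow_field' t)"
  unfolding C1_with_def
proof (intro allI conjI)
  fix x :: "real ^ 'n"
  have "((\<lambda>x. x /\<^sub>R t) has_derivative (\<lambda>v. v /\<^sub>R t)) (at x)"
    by (auto intro!: derivative_eq_intros)
  from has_derivative_compose[OF this C1_withD(1)[OF C1_profile]]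
  have "(flow_field t has_derivative (\<lambda>v. profile' (x /\<^sub>R t) (v /\<^sub>R t))) (at x)"
    by (simp add: flow_field_def[abs_def])
  also have "(\<lambda>v. profile' (x /\<^sub>R t) (v /\<^sub>R t)) = flow_field' t x"
    by (simp add: fun_eq_iff flow_field'_def profile'_def scaleR_add_right divide_inverse mult_ac)
  finally show "(flow_field t has_derivative flow_field' t x) (at x)" .
next
  fix v :: "real ^ 'n"
  show "continuous_on UNIV (\<lambda>x. flow_field' t x v)"
    unfolding flow_field'_def
    by (intro continuous_intros continuous_on_compose2[OF C1_withD(2)[OF C1_profile]]) auto
qed

lemma continuous_on_dilate:
  fixes f :: "'a::euclidean_space \<Rightarrow> 'b::topological_space"
  assumes "continuous_on UNIV f"
  shows "continuous_on ({0<..} \<times> UNIV) (\<lambda>(t::real, x). f (x /\<^sub>R t))"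
  unfolding case_prod_beta
  by (intro continuous_on_compose2[OF assms] continuous_intros) auto

lemma continuous_on_field:
  "continuous_on ({0<..} \<times> UNIV) (\<lambda>(t, x). flow_field t x)"
  "continuous_on ({0<..} \<times> UNIV) (\<lambda>(t, x). flow_field' t x v)"
proof -
  show "continuous_on ({0<..} \<times> UNIV) (\<lambda>(t, x). flow_field t x)"
    unfolding flow_field_def by (rule continuous_on_dilate[OF C1_withD(3)[OF C1_profile]])
  have "continuous_on ({0<..} \<times> UNIV) (\<lambda>(t, x). (1 / t) *\<^sub>R (case (t, x) of (t, x) \<Rightarrow> profile' (x /\<^sub>R t) v))"
    using continuous_on_dilate[OF C1_withD(2)[OF C1_profile, of v]] unfolding case_prod_beta
    by (intro continuous_intros) auto
  then show "continuous_on ({0<..} \<times> UNIV) (\<lambda>(t, x). flow_field' t x v)"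
    by (simp add: flow_field'_def case_prod_beta)
qed

lemma open_slab: "open (slab T)"
  unfolding slab_def by (intro open_Times) auto

lemma slab_sets: "slab T \<in> sets lebesgue"
  by (intro sets_completionI_sets) (simp add: borel_open open_slab)

lemma measurable_slab_continuous:
  fixes f :: "real \<Rightarrow> real ^ 'n::finite \<Rightarrow> 'b::euclidean_space"
  assumes "continuous_on ({0<..} \<times> UNIV) (\<lambda>(t, x). f t x)"
  shows "(\<lambda>(t, x). f t x) \<in> borel_measurable (lebesgue_on (slab T))"
proof (rule continuous_imp_measurable_on_sets_lebesgue)
  show "continuous_on (slab T) (\<lambda>(t, x). f t x)"
    by (rule continuous_on_subset[OF assms]) (auto simp: slab_def)
qed (rule slab_sets)

lemma nn_integral_time_bounded:
  fixes T :: real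
  assumes "\<And>t. t \<in> {0<..<T} \<Longrightarrow> f t \<le> c" "c < \<infinity>" "T > 0"
  shows "(\<integral>\<^sup>+t. f t \<partial>lebesgue_on {0<..<T}) < \<infinity>"
proof -
  have "(\<integral>\<^sup>+t. f t \<partial>lebesgue_on {0<..<T}) \<le> (\<integral>\<^sup>+t. c \<partial>lebesgue_on {0<..<T})"
    using assms by (intro nn_integral_mono) auto
  also have "\<dots> = c * ennreal T" using assms by (simp add: emeasure_restrict_space)
  also have "\<dots> < \<infinity>" using assms by (simp add: ennreal_mult_less_top)
  finally show ?thesis .
qed

lemma L1_norm_le:
  assumes "f \<in> borel_measurable lebesgue" "\<Omega> \<in> sets lebesgue"
  shows "L1_norm \<Omega> f \<le> (\<integral>\<^sup>+x. ennreal (norm (f x)) \<partial>lebesgue)"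
proof -
  have "(\<integral>\<^sup>+x. ennreal (norm (f x)) * indicator \<Omega> x \<partial>lebesgue) \<le> (\<integral>\<^sup>+x. ennreal (norm (f x)) \<partial>lebesgue)"
    by (intro nn_integral_mono) (auto simp: indicator_def)
  then show ?thesis
    using assms measurable_restrict_space1[OF assms(1), of \<Omega>]
    by (simp add: L1_norm_def nn_integral_restrict_space)
qed

lemma nn_integral_norm_finite:
  fixes f :: "'a::euclidean_space \<Rightarrow> 'b::euclidean_space"
  assumes "continuous_on UNIV f" "compact K" "\<And>x. x \<notin> K \<Longrightarrow> f x = 0"
  shows "(\<integral>\<^sup>+x. ennreal (norm (f x)) \<partial>lebesgue) < \<infinity>"
  using integrable_continuous_compact_support[OF assms]
  unfolding integrable_iff_bounded nn_integral_completion by simp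

lemma borel_imp_lebesgue_measurable:
  "f \<in> borel_measurable borel \<Longrightarrow> f \<in> borel_measurable lebesgue"
  by (simp add: measurable_completion)

lemma field_in_L1_W11loc:
  assumes T: "T > 0"
  shows "(flow_field :: real \<Rightarrow> real ^ 'n::finite \<Rightarrow> real ^ 'n) \<in> L1_W11loc T"
  unfolding L1_W11loc_def L1_time_def
proof (safe intro!: measurable_slab_continuous[OF continuous_on_field(1)])
  fix a :: "real ^ 'n" and r :: real
  show "(\<lambda>t. W11_norm (ball a r) (flow_field t)) \<in> borel_measurable (lebesgue_on {0<..<T})"
    by (rule W11_norm_measurable_in_time[OF C1_field continuous_on_field])
  let ?P = "\<integral>\<^sup>+x. ennreal (norm (profile x :: real ^ 'n)) \<partial>lebesgue"
  let ?P' = "\<lambda>i. \<integral>\<^sup>+x. ennreal (norm (profile' x (axis i 1 :: real ^ 'n))) \<partial>lebesgue"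
  let ?N = "CARD('n)"
  let ?c = "ennreal (T ^ ?N) * ?P + (\<Sum>i\<in>UNIV. ennreal (T ^ (?N - 1)) * ?P' i)"
  show "(\<integral>\<^sup>+t. W11_norm (ball a r) (flow_field t :: real ^ 'n \<Rightarrow> real ^ 'n) \<partial>lebesgue_on {0<..<T}) < \<infinity>"
  proof (rule nn_integral_time_bounded[OF _ _ T])
    show "?c < \<infinity>"
    proof -
      have "?P < \<infinity>"
        by (rule nn_integral_norm_finite[OF C1_withD(3)[OF C1_profile] compact_cball profile_outside(1)])
      moreover have "?P' i < \<infinity>" for i
        by (rule nn_integral_norm_finite[OF C1_withD(2)[OF C1_profile] compact_cball profile_outside(2)])
      ultimately show ?thesis by (simp add: ennreal_add_less_top ennreal_mult_less_top)
    qed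
    fix t assume t: "t \<in> {0<..<T}"
    have m: "(\<lambda>x. f x) \<in> borel_measurable lebesgue" if "continuous_on UNIV f" for f :: "real ^ 'n \<Rightarrow> real ^ 'n"
      using that by (intro borel_imp_lebesgue_measurable borel_measurable_continuous_onI)
    have p: "(profile :: real ^ 'n \<Rightarrow> real ^ 'n) \<in> borel_measurable lebesgue" "(\<lambda>x. profile' x v) \<in> borel_measurable lebesgue" for v :: "real ^ 'n"
      by (simp_all add: m C1_withD(2,3)[OF C1_profile])
    have pn: "(\<lambda>x. ennreal (norm (profile x :: real ^ 'n))) \<in> borel_measurable lebesgue"
       "(\<lambda>x. ennreal (norm (profile' x (v :: real ^ 'n)))) \<in> borel_measurable lebesgue" for v
      using p by (auto intro!: measurable_compose[OF _ measurable_ennreal])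
    have "W11_norm (ball a r) (flow_field t :: real ^ 'n \<Rightarrow> real ^ 'n)
        \<le> W11_sum (ball a r) (flow_field t) (\<lambda>i x. flow_field' t x (axis i 1))"
      by (intro W11_norm_le has_weak_partial_C1 C1_field)
    also have "\<dots> \<le> (\<integral>\<^sup>+x. ennreal (norm (flow_field t x :: real ^ 'n)) \<partial>lebesgue)
        + (\<Sum>i\<in>UNIV. \<integral>\<^sup>+x. ennreal (norm (flow_field' t x (axis i 1 :: real ^ 'n))) \<partial>lebesgue)"
      unfolding W11_sum_def by (intro add_mono sum_mono L1_norm_le m C1_withD(2,3)[OF C1_field]) auto
    also have "\<dots> \<le> ?c"
    proof (intro add_mono sum_mono)
      have "(\<integral>\<^sup>+x. ennreal (norm (flow_field t x :: real ^ 'n)) \<partial>lebesgue) = ennreal (t ^ ?N) * ?P"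
        using nn_integral_dilate[OF pn(1), of t] t by (simp add: flow_field_def)
      also have "\<dots> \<le> ennreal (T ^ ?N) * ?P"
        using t by (intro mult_right_mono ennreal_leI power_mono) auto
      finally show "(\<integral>\<^sup>+x. ennreal (norm (flow_field t x :: real ^ 'n)) \<partial>lebesgue) \<le> ennreal (T ^ ?N) * ?P" .
      fix i
      have "(\<integral>\<^sup>+x. ennreal (norm (flow_field' t x (axis i 1 :: real ^ 'n))) \<partial>lebesgue)
          = (\<integral>\<^sup>+x. ennreal (1 / t) * ennreal (norm (profile' (x /\<^sub>R t) (axis i 1 :: real ^ 'n))) \<partial>lebesgue)"
        using t by (intro nn_integral_cong) (simp add: flow_field'_def ennreal_mult'[symmetric])
      also have "\<dots> = ennreal (1 / t) * (ennreal (t ^ ?N) * ?P' i)"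
        using nn_integral_dilate[OF pn(2), of t "axis i 1"] t measurable_dilate[OF pn(2), of t "axis i 1"]
        by (simp add: nn_integral_cmult)
      also have "\<dots> = ennreal (t ^ (?N - 1)) * ?P' i"
      proof -
        have "1 / t * t ^ ?N = t ^ (?N - 1)"
          using t by (simp add: power_eq_if[of t ?N])
        then show ?thesis using t by (simp add: mult.assoc[symmetric] flip: ennreal_mult')
      qed
      also have "\<dots> \<le> ennreal (T ^ (?N - 1)) * ?P' i"
        using t by (intro mult_right_mono ennreal_leI power_mono) auto
      finally show "(\<integral>\<^sup>+x. ennreal (norm (flow_field' t x (axis i 1 :: real ^ 'n))) \<partial>lebesgue) \<le> ennreal (T ^ (?N - 1)) * ?P' i" .
    qed
    finally show "W11_norm (ball a r) (flow_field t :: real ^ 'n \<Rightarrow> real ^ 'n) \<le> ?c" .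
  qed
qed

lemma dilate_in_Linf_Linf:
  fixes f :: "real ^ 'n::finite \<Rightarrow> 'b::euclidean_space"
  assumes f: "f \<in> borel_measurable borel" "\<And>x. norm (f x) \<le> M"
    and meas: "(\<lambda>(t, x). f (x /\<^sub>R t)) \<in> borel_measurable (lebesgue_on (slab T))"
  shows "(\<lambda>t x. f (x /\<^sub>R t)) \<in> Linf_Linf T"
proof -
  have eq: "Linf_norm (\<lambda>x. f (x /\<^sub>R t)) = Linf_norm f" if "t \<in> {0<..<T}" for t
    using that by (intro Linf_norm_dilate) auto
  have m: "(\<lambda>t. Linf_norm (\<lambda>x. f (x /\<^sub>R t))) \<in> borel_measurable (lebesgue_on {0<..<T})"
    using eq by (subst measurable_cong[where g = "\<lambda>_. Linf_norm f"]) auto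
  have "Linf_norm f \<le> ennreal M"
    using f(2) borel_imp_lebesgue_measurable[OF f(1)] unfolding Linf_norm_def
    by (auto intro!: esssup_I AE_I2 ennreal_leI measurable_compose[OF _ measurable_ennreal])
  then have "esssup (lebesgue_on {0<..<T}) (\<lambda>t. Linf_norm (\<lambda>x. f (x /\<^sub>R t))) \<le> ennreal M"
    using eq m by (intro esssup_I) (auto intro!: AE_I2)
  also have "\<dots> < \<infinity>" by simp
  finally show ?thesis using m meas by (simp add: Linf_Linf_def Linf_time_def)
qed

lemma field_in_Linf_Linf: "(flow_field :: real \<Rightarrow> real ^ 'n::finite \<Rightarrow> real ^ 'n) \<in> Linf_Linf T"
proof -
  obtain M where "\<And>x. norm (profile x :: real ^ 'n) \<le> M"
    using bounded_continuous_compact_support[OF C1_withD(3)[OF C1_profile] compact_cball profile_outside(1)]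
    by metis
  moreover have "profile \<in> borel_measurable (borel :: (real ^ 'n) measure)"
    by (intro borel_measurable_continuous_onI C1_withD(3)[OF C1_profile])
  ultimately have "(\<lambda>t (x :: real ^ 'n). profile (x /\<^sub>R t)) \<in> Linf_Linf T"
    using measurable_slab_continuous[OF continuous_on_field(1), of T]
    by (intro dilate_in_Linf_Linf) (auto simp: flow_field_def)
  then show ?thesis by (simp add: flow_field_def[abs_def])
qed

lemma field_div: "(\<Sum>i\<in>UNIV. flow_field' t x (axis i 1) $ i) = (1 / t) * profile_div (x /\<^sub>R t)"
  by (simp add: flow_field'_def profile_div_def sum_distrib_left)

lemma field_div_in_L1_Exp:
  assumes T: "T > 0" and \<gamma>: "\<gamma> > 1"
  shows "div_in_L1_Exp T \<gamma> (flow_field :: real \<Rightarrow> real ^ 'n::finite \<Rightarrow> real ^ 'n)"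
  unfolding div_in_L1_Exp_def
proof (intro bexI AE_I2)
  let ?d = "\<lambda>(t::real) (x :: real ^ 'n). (1 / t) * profile_div (x /\<^sub>R t)"
  show "has_weak_div (flow_field t) (?d t)" for t
    using has_weak_div_C1[OF C1_field, of t] by (simp add: field_div)
  have c: "continuous_on UNIV (profile_div :: real ^ 'n \<Rightarrow> real)"
    unfolding profile_div_def[abs_def] by (intro continuous_intros C1_withD(2)[OF C1_profile])
  have z: "profile_div y = 0" if "y \<notin> cball 0 2" for y :: "real ^ 'n"
    using profile_outside(2)[OF that] by (simp add: profile_div_def)
  obtain M where M: "M > 0" "\<And>x. norm (profile_div (x :: real ^ 'n)) \<le> M"
    using bounded_continuous_compact_support[OF c compact_cball z] by metis
  have m: "(profile_div :: real ^ 'n \<Rightarrow> real) \<in> borel_measurable lebesgue"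
    using c by (intro borel_imp_lebesgue_measurable borel_measurable_continuous_onI)
  \<comment> \<open>adding 1 only serves to make the bound positive without computing the volume\<close>
  define V where "V = measure lebesgue (cball (0 :: real ^ 'n) 2) + 1"
  have V: "V > 0" unfolding V_def by (smt (verit) measure_nonneg)
  have VK: "emeasure lebesgue (cball (0 :: real ^ 'n) 2) \<le> ennreal V"
    using emeasure_bounded_finite[of "cball (0 :: real ^ 'n) 2"]
    by (simp add: V_def emeasure_eq_ennreal_measure less_top ennreal_leI)
  let ?L = "\<lambda>t. ln (1 + 1 / (V * t ^ CARD('n)))"
  have "(\<integral>\<^sup>+t. Exp_norm \<gamma> (?d t) \<partial>lebesgue_on {0<..<T})
      \<le> (\<integral>\<^sup>+t. ennreal (M / (t * (?L t * log_plus (?L t) powr \<gamma>))) \<partial>lebesgue_on {0<..<T})"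
    using M V VK z \<gamma> by (intro nn_integral_mono Exp_norm_dilate_le[OF m, where K = "cball 0 2"]) auto
  also have "\<dots> < \<infinity>"
    using critical_integral_finite[OF \<gamma> V M(1) _ T, of "CARD('n)"] by (simp add: Suc_leI)
  finally have fin: "(\<integral>\<^sup>+t. Exp_norm \<gamma> (?d t) \<partial>lebesgue_on {0<..<T}) < \<infinity>" .
  have "continuous_on ({0<..} \<times> UNIV) (\<lambda>(t, x). (1 / t) * (case (t, x) of (t, x) \<Rightarrow> profile_div (x /\<^sub>R t :: real ^ 'n)))"
    using continuous_on_dilate[OF c] unfolding case_prod_beta by (intro continuous_intros) auto
  then have "(\<lambda>(t, x). ?d t x) \<in> borel_measurable (lebesgue_on (slab T))"
    by (intro measurable_slab_continuous) (simp add: case_prod_beta)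
  then show "?d \<in> L1_time T (Exp_norm \<gamma>)"
    using fin Exp_norm_dilate_measurable[OF m, of \<gamma> T] by (simp add: L1_time_def)
qed

section \<open>The fan of non-trivial solutions\<close>

text \<open>The indicator function of the ball \<open>|x| < t\<close>, the region filled by trajectories leaving the
  origin at time 0.\<close>

definition fan :: "real \<Rightarrow> real ^ 'n::finite \<Rightarrow> real" where
  "fan t x = indicator (ball 0 1) (x /\<^sub>R t)"

text \<open>The space-time set on which the solutions below are nonzero.\<close>

definition fan_region :: "real \<Rightarrow> (real \<times> (real ^ 'n::finite)) set" where
  "fan_region T = {(t, x). 0 < t \<and> t < T \<and> norm x < t}"

lemma open_fan_region: "open (fan_region T :: (real \<times> (real ^ 'n::finite)) set)"
proof -
  have eq: "(fan_region T :: (real \<times> (real ^ 'n)) set)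
      = {p. 0 < fst p} \<inter> {p. fst p < T} \<inter> {p. norm (snd p) < fst p}"
    by (auto simp: fan_region_def)
  show ?thesis
    unfolding eq by (intro open_Int open_Collect_less continuous_intros)
qed

lemma fan_region_sets: "fan_region T \<in> sets borel" "fan_region T \<in> sets lebesgue"
  by (simp_all add: borel_open open_fan_region sets_completionI_sets)

lemma fan_eq: "t > 0 \<Longrightarrow> fan t x = (if norm x < t then 1 else 0)"
  by (simp add: fan_def indicator_def inverse_eq_divide pos_divide_less_eq)

lemma fan_measurable:
  "(\<lambda>(t, x). c * fan t (x :: real ^ 'n::finite)) \<in> borel_measurable (lebesgue_on (slab T))"
proof -
  have "(\<lambda>p. c * indicator (fan_region T) p) \<in> borel_measurable (lebesgue :: (real \<times> (real ^ 'n)) measure)"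
    by (intro borel_imp_lebesgue_measurable borel_measurable_times borel_measurable_const
        borel_measurable_indicator fan_region_sets)
  then have "(\<lambda>p. c * indicator (fan_region T) p) \<in> borel_measurable (lebesgue_on (slab T :: (real \<times> (real ^ 'n)) set))"
    by (rule measurable_restrict_space1)
  then show ?thesis
    by (rule measurable_cong[THEN iffD1, rotated])
       (auto simp: slab_def fan_eq fan_region_def indicator_def space_restrict_space split: if_splits)
qed

lemma fan_in_Linf_Linf: "(\<lambda>t x. c * fan t (x :: real ^ 'n::finite)) \<in> Linf_Linf T"
  unfolding fan_def
proof (rule dilate_in_Linf_Linf)
  show "(\<lambda>x. c * indicator (ball 0 1) x) \<in> borel_measurable (borel :: (real ^ 'n) measure)"
    by (intro borel_measurable_times borel_measurable_const borel_measurable_indicator) simp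
  show "norm (c * indicator (ball 0 1) x) \<le> \<bar>c\<bar>" for x :: "real ^ 'n"
    by (simp add: indicator_def)
qed (use fan_measurable in \<open>simp add: fan_def\<close>)

lemma fan_in_L1_L1loc:
  assumes T: "T > 0" shows "(\<lambda>t x. c * fan t (x :: real ^ 'n::finite)) \<in> L1_L1loc T"
  unfolding L1_L1loc_def L1_time_def
proof (safe intro!: fan_measurable)
  fix a :: "real ^ 'n" and r :: real
  have m: "(\<lambda>x. c * fan t x) \<in> borel_measurable (lebesgue_on (ball a r))" for t
  proof -
    have "(\<lambda>x :: real ^ 'n. x /\<^sub>R t) \<in> borel \<rightarrow>\<^sub>M borel" by simp
    moreover have "(\<lambda>y. c * indicator (ball 0 1) y) \<in> borel_measurable (borel :: (real ^ 'n) measure)"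
      by (intro borel_measurable_times borel_measurable_const borel_measurable_indicator) simp
    ultimately have "(\<lambda>x. c * fan t x) \<in> borel_measurable (borel :: (real ^ 'n) measure)"
      unfolding fan_def by (rule measurable_compose)
    then show ?thesis by (intro measurable_restrict_space1 borel_imp_lebesgue_measurable)
  qed
  have L: "L1_norm (ball a r) (\<lambda>x. c * fan t x) = (\<integral>\<^sup>+x. ennreal \<bar>c * fan t x\<bar> \<partial>lebesgue_on (ball a r))" for t
    using m by (simp add: L1_norm_def)
  show "(\<lambda>t. L1_norm (ball a r) (\<lambda>x. c * fan t x)) \<in> borel_measurable (lebesgue_on {0<..<T})"
    unfolding L
    by (intro borel_measurable_mono_on_Ioo monotone_onI nn_integral_mono) (auto simp: fan_eq)
  show "(\<integral>\<^sup>+t. L1_norm (ball a r) (\<lambda>x. c * fan t x) \<partial>lebesgue_on {0<..<T}) < \<infinity>"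
  proof (rule nn_integral_time_bounded[OF _ _ T])
    fix t :: real
    have "(\<integral>\<^sup>+x. ennreal \<bar>c * fan t x\<bar> \<partial>lebesgue_on (ball a r)) \<le> (\<integral>\<^sup>+x. ennreal \<bar>c\<bar> \<partial>lebesgue_on (ball a r))"
      by (intro nn_integral_mono ennreal_leI) (auto simp: fan_def indicator_def)
    also have "\<dots> = ennreal \<bar>c\<bar> * emeasure lebesgue (ball a r)" by (simp add: emeasure_restrict_space)
    finally show "L1_norm (ball a r) (\<lambda>x. c * fan t x) \<le> ennreal \<bar>c\<bar> * emeasure lebesgue (ball a r)"
      unfolding L .
    show "ennreal \<bar>c\<bar> * emeasure lebesgue (ball a r) < \<infinity>"
      using emeasure_bounded_finite[of "ball a r"] by (simp add: ennreal_mult_less_top)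
  qed
qed

text \<open>Different multiples of the fan differ on \<open>fan_region T\<close>, which is open and nonempty, hence not
  negligible.\<close>

lemma fan_infinitely_many_classes:
  assumes T: "T > 0" and S: "\<And>c. (\<lambda>t (x :: real ^ 'n::finite). c * fan t x) \<in> S"
  shows "infinite (S // slab_ae_eq T)"
proof
  let ?u = "\<lambda>(c :: real) t (x :: real ^ 'n). c * fan t x"
  let ?cl = "\<lambda>c. slab_ae_eq T `` {?u c}"
  have "inj ?cl"
  proof (rule injI)
    fix c c' assume eq: "?cl c = ?cl c'"
    have "?u c' \<in> ?cl c'" by (simp add: slab_ae_eq_def)
    then have "?u c' \<in> ?cl c" using eq by simp
    then have ae: "AE p in lebesgue_on (slab T). case p of (t, x) \<Rightarrow> ?u c t x = ?u c' t x"
      by (simp add: slab_ae_eq_def case_prod_beta)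
    show "c = c'"
    proof (rule ccontr)
      assume ne: "c \<noteq> c'"
      have "AE p in lebesgue. p \<in> (slab T :: (real \<times> (real ^ 'n)) set) \<longrightarrow> (case p of (t, x) \<Rightarrow> ?u c t x = ?u c' t x)"
        using ae by (subst (asm) AE_restrict_space_iff) (auto simp: slab_sets)
      then have "AE p in lebesgue. p \<notin> (fan_region T :: (real \<times> (real ^ 'n)) set)"
        by (rule AE_mp) (use ne in \<open>auto simp: fan_region_def slab_def fan_eq intro!: AE_I2\<close>)
      moreover have "(fan_region T :: (real \<times> (real ^ 'n)) set) \<in> sets lebesgue"
        by (rule fan_region_sets)
      ultimately have "negligible (fan_region T :: (real \<times> (real ^ 'n)) set)"
        by (simp add: negligible_iff_null_sets AE_iff_null_sets)
      moreover have "(T / 2, 0 :: real ^ 'n) \<in> fan_region T" using T by (simp add: fan_region_def)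
      ultimately show False using open_not_negligible[OF open_fan_region[of T]] by blast
    qed
  qed
  moreover have "range ?cl \<subseteq> S // slab_ae_eq T" using S by (auto intro!: quotientI)
  moreover assume "finite (S // slab_ae_eq T)"
  ultimately have "finite (UNIV :: real set)"
    using finite_subset finite_imageD by metis
  then show False using infinite_UNIV_char_0 by blast
qed

lemma zero_Cc_smooth: "(\<lambda>_. 0) \<in> Cc_smooth UNIV"
proof -
  have "Ck_on k UNIV (\<lambda>_::'a. 0)" for k
    by (induction k) (auto simp: frechet_derivative_const)
  then show ?thesis by (simp add: Cc_smooth_def smooth_on_def)
qed

section \<open>Test functions on the time slab\<close>

text \<open>The derivative of a test function within the closed slab.\<close>

definition test_deriv :: "real \<Rightarrow> (real \<times> (real ^ 'n::finite) \<Rightarrow> real) \<Rightarrow> real \<times> (real ^ 'n) \<Rightarrow> real \<times> (real ^ 'n) \<Rightarrow> real" where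
  "test_deriv T \<phi> p = frechet_derivative \<phi> (at p within ({0..T} \<times> UNIV))"

lemma test_fun_facts:
  assumes \<phi>: "\<phi> \<in> test_fun T" and T: "T > 0"
  shows "continuous_on ({0..T} \<times> UNIV) \<phi>"
    and "continuous_on ({0..T} \<times> UNIV) (\<lambda>p. test_deriv T \<phi> p v)"
    and "0 < t \<Longrightarrow> t < T \<Longrightarrow> (\<phi> has_derivative test_deriv T \<phi> (t, x)) (at (t, x))"
    and "\<phi> (T, x) = 0"
proof -
  let ?S = "{0..T} \<times> (UNIV :: (real ^ 'n) set)"
  have "Ck_on 2 ?S \<phi>" using \<phi> by (simp add: test_fun_def smooth_on_def)
  then have d: "\<phi> differentiable_on ?S" "\<And>v. (\<lambda>p. test_deriv T \<phi> p v) differentiable_on ?S"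
    by (auto simp: numeral_2_eq_2 test_deriv_def)
  then show "continuous_on ?S \<phi>" "continuous_on ?S (\<lambda>p. test_deriv T \<phi> p v)"
    by (simp_all only: differentiable_imp_continuous_on)
  show "(\<phi> has_derivative test_deriv T \<phi> (t, x)) (at (t, x))" if "0 < t" "t < T"
  proof -
    have "(t, x) \<in> interior ?S" using that by (simp add: interior_Times)
    then have "at (t, x) within ?S = at (t, x)" by (rule at_within_interior)
    moreover have "\<phi> differentiable (at (t, x) within ?S)"
      using d(1) that by (auto simp: differentiable_on_def)
    ultimately show ?thesis by (simp add: test_deriv_def frechet_derivative_works)
  qed
  have "closure {p \<in> ?S. \<phi> p \<noteq> 0} \<subseteq> {0..<T} \<times> UNIV" using \<phi> by (simp add: test_fun_def Let_def)
  then have "(T, x) \<notin> closure {p \<in> ?S. \<phi> p \<noteq> 0}" by auto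
  then have "(T, x) \<notin> {p \<in> ?S. \<phi> p \<noteq> 0}" using closure_subset by (rule contra_subsetD[rotated])
  then show "\<phi> (T, x) = 0" using T by simp
qed

lemma test_deriv_linear:
  fixes \<phi> :: "real \<times> (real ^ 'n::finite) \<Rightarrow> real"
  assumes "\<phi> \<in> test_fun T" "T > 0" "0 < t" "t < T"
  shows "test_deriv T \<phi> (t, x) (0, y) = (\<Sum>i\<in>UNIV. y $ i * test_deriv T \<phi> (t, x) (0, axis i 1))"
    and "test_deriv T \<phi> (t, x) (a, y) = a * test_deriv T \<phi> (t, x) (1, 0) + test_deriv T \<phi> (t, x) (0, y)"
proof -
  have lin: "linear (test_deriv T \<phi> (t, x))"
    using test_fun_facts(3)[OF assms] by (rule has_derivative_linear)
  have "(0, y) = (\<Sum>i\<in>UNIV. y $ i *\<^sub>R (0 :: real, axis i 1 :: real ^ 'n))"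
  proof -
    have "y = (\<Sum>i\<in>UNIV. y $ i *\<^sub>R axis i 1)"
      using basis_expansion[of y] by (simp add: scalar_mult_eq_scaleR)
    then show ?thesis by (auto simp: prod_eq_iff fst_sum snd_sum)
  qed
  then have "test_deriv T \<phi> (t, x) (0, y) = test_deriv T \<phi> (t, x) (\<Sum>i\<in>UNIV. y $ i *\<^sub>R (0 :: real, axis i 1))"
    by simp
  then show "test_deriv T \<phi> (t, x) (0, y) = (\<Sum>i\<in>UNIV. y $ i * test_deriv T \<phi> (t, x) (0, axis i 1))"
    by (simp only: linear_sum[OF lin] linear_scale[OF lin] real_scaleR_def)
  have "(a, y) = a *\<^sub>R (1, 0) + (0, y)" by simp
  then have "test_deriv T \<phi> (t, x) (a, y) = test_deriv T \<phi> (t, x) (a *\<^sub>R (1, 0) + (0, y))" by (simp only:)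
  then show "test_deriv T \<phi> (t, x) (a, y) = a * test_deriv T \<phi> (t, x) (1, 0) + test_deriv T \<phi> (t, x) (0, y)"
    by (simp only: linear_add[OF lin] linear_scale[OF lin] real_scaleR_def)
qed

text \<open>The divergence of \<open>\<phi>(t,\<cdot>)\<close> times the field.\<close>

definition test_div :: "real \<Rightarrow> (real \<times> (real ^ 'n::finite) \<Rightarrow> real) \<Rightarrow> real \<Rightarrow> real ^ 'n \<Rightarrow> real" where
  "test_div T \<phi> t x = (\<Sum>i\<in>UNIV. (\<phi> (t, x) *\<^sub>R flow_field' t x (axis i 1) + test_deriv T \<phi> (t, x) (0, axis i 1) *\<^sub>R flow_field t x) $ i)"

lemma has_weak_div_test_div:
  fixes \<phi> :: "real \<times> (real ^ 'n::finite) \<Rightarrow> real"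
  assumes \<phi>: "\<phi> \<in> test_fun T" and T: "T > 0" and t: "0 < t" "t < T"
  shows "has_weak_div (\<lambda>x. \<phi> (t, x) *\<^sub>R flow_field t x) (test_div T \<phi> t)"
proof -
  note f = test_fun_facts[OF \<phi> T]
  have d: "((\<lambda>x. \<phi> (t, x)) has_derivative (\<lambda>v. test_deriv T \<phi> (t, x) (0, v))) (at x)" for x
  proof -
    have "((\<lambda>x. (t, x)) has_derivative (\<lambda>v. (0, v))) (at x)"
      by (intro has_derivative_Pair has_derivative_const has_derivative_ident)
    from has_derivative_compose[OF this f(3)[OF t]] show ?thesis .
  qed
  have c: "continuous_on UNIV (\<lambda>x. \<phi> (t, x))" "continuous_on UNIV (\<lambda>x. test_deriv T \<phi> (t, x) v)" for v
    by (rule continuous_on_compose2[OF f(1)] continuous_on_compose2[OF f(2)];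
        use t in \<open>auto intro!: continuous_intros\<close>)+
  have "C1_with (\<lambda>x. \<phi> (t, x) *\<^sub>R flow_field t x)
      (\<lambda>x v. \<phi> (t, x) *\<^sub>R flow_field' t x v + test_deriv T \<phi> (t, x) (0, v) *\<^sub>R flow_field t x)"
    unfolding C1_with_def
    by (intro allI conjI has_derivative_scaleR continuous_intros d c C1_withD[OF C1_field])
  from has_weak_div_C1[OF this] show ?thesis by (simp add: test_div_def[abs_def])
qed

lemma test_div_inside:
  fixes \<phi> :: "real \<times> (real ^ 'n::finite) \<Rightarrow> real"
  assumes t: "0 < t" and x: "norm x < t"
  shows "test_div T \<phi> t x = (real CARD('n) * \<phi> (t, x) + (\<Sum>i\<in>UNIV. x $ i * test_deriv T \<phi> (t, x) (0, axis i 1))) / t"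
proof -
  have "norm (x /\<^sub>R t) \<le> 1" using assms by (simp add: inverse_eq_divide pos_divide_le_eq)
  note i = profile_inside[OF this]
  have "test_div T \<phi> t x = (\<Sum>i\<in>UNIV. \<phi> (t, x) / t + x $ i * test_deriv T \<phi> (t, x) (0, axis i 1) / t)"
    by (simp add: test_div_def flow_field_def flow_field'_def i divide_inverse mult_ac)
  also have "\<dots> = (real CARD('n) * \<phi> (t, x) + (\<Sum>i\<in>UNIV. x $ i * test_deriv T \<phi> (t, x) (0, axis i 1))) / t"
    by (simp add: sum.distrib add_divide_distrib sum_divide_distrib)
  finally show ?thesis .
qed

section \<open>The weak formulation\<close>

text \<open>The singularity \<open>1 / t\<close> is integrable over the cone \<open>\<bar>x\<bar> < t\<close>, also in dimension one, because the
  slice at time \<open>t\<close> has measure proportional to \<open>t\<^sup>n\<close>.\<close>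

lemma integrable_fan_region:
  fixes g :: "real \<times> (real ^ 'n::finite) \<Rightarrow> real"
  assumes [measurable]: "g \<in> borel_measurable borel" and M: "M \<ge> 0" and T: "T > 0"
    and g: "\<And>t x. \<bar>g (t, x)\<bar> \<le> M / t * indicator (fan_region T) (t, x)"
  shows "integrable (lborel \<Otimes>\<^sub>M lborel) g"
proof (rule integrableI_bounded)
  show m: "g \<in> borel_measurable (lborel \<Otimes>\<^sub>M lborel)" by (simp add: lborel_prod)
  let ?V = "unit_ball_vol (real CARD('n))" and ?N = "CARD('n)"
  have inner: "(\<integral>\<^sup>+x. ennreal (norm (g (t, x))) \<partial>lborel) \<le> ennreal (M * T ^ (?N - 1) * ?V) * indicator {0<..<T} t" for t
  proof (cases "t \<in> {0<..<T}")
    case t: True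
    have "(\<integral>\<^sup>+x. ennreal (norm (g (t, x))) \<partial>lborel) \<le> (\<integral>\<^sup>+x. ennreal (M / t) * indicator (ball (0 :: real ^ 'n) t) x \<partial>lborel)"
    proof (rule nn_integral_mono)
      fix x :: "real ^ 'n"
      have "norm (g (t, x)) \<le> M / t * indicator (ball 0 t) x"
        using g[of t x] t by (auto simp: fan_region_def indicator_def split: if_splits)
      then have "ennreal (norm (g (t, x))) \<le> ennreal (M / t * indicator (ball 0 t) x)" by (rule ennreal_leI)
      then show "ennreal (norm (g (t, x))) \<le> ennreal (M / t) * indicator (ball 0 t) x"
        by (auto simp: indicator_def split: if_splits)
    qed
    also have "\<dots> = ennreal (M / t) * ennreal (?V * t ^ ?N)"
      using t by (simp add: nn_integral_cmult_indicator emeasure_ball)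
    also have "\<dots> = ennreal (M * t ^ (?N - 1) * ?V)"
      using t M by (simp add: power_eq_if[of t ?N] ennreal_mult'[symmetric] mult_ac)
    also have "\<dots> \<le> ennreal (M * T ^ (?N - 1) * ?V)"
      using t M by (intro ennreal_leI mult_right_mono mult_left_mono power_mono) auto
    finally show ?thesis using t by simp
  next
    case False
    then have "g (t, x) = 0" for x using g[of t x] by (auto simp: fan_region_def)
    then show ?thesis by simp
  qed
  have "(\<integral>\<^sup>+p. ennreal (norm (g p)) \<partial>(lborel \<Otimes>\<^sub>M lborel)) = (\<integral>\<^sup>+t. \<integral>\<^sup>+x. ennreal (norm (g (t, x))) \<partial>lborel \<partial>lborel)"
    using m by (subst lborel.nn_integral_fst[symmetric]) auto
  also have "\<dots> \<le> (\<integral>\<^sup>+t. ennreal (M * T ^ (?N - 1) * ?V) * indicator {0<..<T} t \<partial>lborel)"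
    by (intro nn_integral_mono inner)
  also have "\<dots> = ennreal (M * T ^ (?N - 1) * ?V) * ennreal T"
    using T by (simp add: nn_integral_cmult_indicator)
  also have "\<dots> < \<infinity>" by (simp add: ennreal_mult_less_top)
  finally show "(\<integral>\<^sup>+p. ennreal (norm (g p)) \<partial>(lborel \<Otimes>\<^sub>M lborel)) < \<infinity>" .
qed

lemma iterated_lebesgue_eq_lborel:
  fixes g :: "real \<times> (real ^ 'n::finite) \<Rightarrow> real"
  assumes g[measurable]: "g \<in> borel_measurable borel" and z: "\<And>t x. t \<notin> {0<..<T} \<Longrightarrow> g (t, x) = 0"
    and eq: "\<And>t x. t \<in> {0<..<T} \<Longrightarrow> f t x = g (t, x)"
  shows "(LINT t|lebesgue_on {0<..<T}. LINT x|lebesgue. f t x) = (LINT t|lborel. LINT x|lborel. g (t, x))"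
proof -
  have gp[measurable]: "g \<in> borel_measurable (lborel \<Otimes>\<^sub>M lborel)" by (simp add: lborel_prod)
  have "(LINT t|lebesgue_on {0<..<T}. LINT x|lebesgue. f t x)
      = (LINT t|lebesgue_on {0<..<T}. LINT x|lebesgue. g (t, x))"
    by (intro Bochner_Integration.integral_cong refl) (auto simp: eq)
  also have "\<dots> = (LINT t|lebesgue. indicator {0<..<T} t *\<^sub>R (LINT x|lebesgue. g (t, x)))"
    by (subst integral_restrict_space) auto
  also have "\<dots> = (LINT t|lebesgue. LINT x|lebesgue. g (t, x))"
  proof (intro Bochner_Integration.integral_cong refl)
    fix t
    show "indicator {0<..<T} t *\<^sub>R (LINT x|lebesgue. g (t, x)) = (LINT x|lebesgue. g (t, x))"
      by (cases "t \<in> {0<..<T}") (simp_all add: z)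
  qed
  also have "\<dots> = (LINT t|lebesgue. LINT x|lborel. g (t, x))"
    by (intro Bochner_Integration.integral_cong refl integral_completion) simp
  also have "\<dots> = (LINT t|lborel. LINT x|lborel. g (t, x))"
    by (intro integral_completion lborel.borel_measurable_lebesgue_integral) simp
  finally show ?thesis .
qed

lemma integral_dilate:
  fixes f :: "'a::euclidean_space \<Rightarrow> real"
  assumes [measurable]: "f \<in> borel_measurable borel" and t: "t > 0"
  shows "(LINT x|lborel. f x) = (LINT y|lborel. t ^ DIM('a) * f (t *\<^sub>R y))"
proof -
  have "(LINT x|lborel. f x) = (LINT x|density (distr lborel borel (\<lambda>x. 0 + t *\<^sub>R x)) (\<lambda>_. ennreal (\<bar>t\<bar> ^ DIM('a))). f x)"
    using lborel_affine[of t "0::'a"] t by (simp add: ennreal_power)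
  also have "\<dots> = (LINT y|lborel. t ^ DIM('a) * f (t *\<^sub>R y))"
    using t by (subst integral_density) (simp_all add: integral_distr)
  finally show ?thesis .
qed

text \<open>In the self-similar variable \<open>y = x / t\<close> the equation becomes an exact time derivative.\<close>

lemma fan_test_derivative:
  fixes \<phi> :: "real \<times> (real ^ 'n::finite) \<Rightarrow> real"
  assumes \<phi>: "\<phi> \<in> test_fun T" and T: "T > 0" and t: "0 < t" "t < T"
  shows "((\<lambda>t. t ^ CARD('n) * \<phi> (t, t *\<^sub>R y)) has_real_derivative
     t ^ CARD('n) * (test_deriv T \<phi> (t, t *\<^sub>R y) (1, 0) + (real CARD('n) * \<phi> (t, t *\<^sub>R y)
       + (\<Sum>i\<in>UNIV. (t *\<^sub>R y) $ i * test_deriv T \<phi> (t, t *\<^sub>R y) (0, axis i 1))) / t)) (at t)"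
proof -
  let ?N = "CARD('n)" and ?D = "test_deriv T \<phi> (t, t *\<^sub>R y)"
  have "((\<lambda>t. (t, t *\<^sub>R y)) has_derivative (\<lambda>h. (h, h *\<^sub>R y))) (at t)"
    by (auto intro!: derivative_eq_intros)
  from has_derivative_compose[OF this test_fun_facts(3)[OF \<phi> T t]]
  have "((\<lambda>t. \<phi> (t, t *\<^sub>R y)) has_derivative (\<lambda>h. ?D (h, h *\<^sub>R y))) (at t)" .
  moreover have "?D (h, h *\<^sub>R y) = ?D (1, y) * h" for h
    using linear_scale[OF has_derivative_linear[OF test_fun_facts(3)[OF \<phi> T t]], of "t *\<^sub>R y" h "(1, y)"] by simp
  ultimately have "((\<lambda>t. \<phi> (t, t *\<^sub>R y)) has_derivative (\<lambda>h. ?D (1, y) * h)) (at t)"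
    by simp
  then have d: "((\<lambda>t. \<phi> (t, t *\<^sub>R y)) has_real_derivative ?D (1, y)) (at t)"
    by (simp add: has_field_derivative_def)
  have e: "?D (1, y) = ?D (1, 0) + (\<Sum>i\<in>UNIV. y $ i * ?D (0, axis i 1))"
    by (simp only: test_deriv_linear(2)[OF \<phi> T t, where a = 1 and y = y]
        test_deriv_linear(1)[OF \<phi> T t, where y = y] mult_1)
  have s: "(\<Sum>i\<in>UNIV. (t *\<^sub>R y) $ i * ?D (0, axis i 1)) = t * (\<Sum>i\<in>UNIV. y $ i * ?D (0, axis i 1))"
    by (simp add: sum_distrib_left mult.assoc)
  have p: "t ^ ?N = t * t ^ (?N - 1)" by (simp add: power_eq_if[of t ?N])
  show ?thesis
  proof (rule DERIV_cong[OF DERIV_mult[OF DERIV_pow[of ?N] d]])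
    show "real ?N * t ^ (?N - Suc 0) * \<phi> (t, t *\<^sub>R y) + ?D (1, y) * t ^ ?N =
      t ^ ?N * (?D (1, 0) + (real ?N * \<phi> (t, t *\<^sub>R y) + (\<Sum>i\<in>UNIV. (t *\<^sub>R y) $ i * ?D (0, axis i 1))) / t)"
      unfolding s e using t p by (simp add: field_simps)
  qed
qed

text \<open>On the ball \<open>\<bar>x\<bar> < t\<close> the vector field is \<open>x / t\<close>. In the variable \<open>y = x / t\<close> the two terms of
  the weak formulation add up to the integral of the time derivative of \<open>t\<^sup>n \<phi>(t, t y)\<close> over the unit
  ball. Integrating in time first gives 0 for every \<open>y\<close>, since \<open>t\<^sup>n\<close> vanishes at 0 and \<open>\<phi>\<close> at \<open>T\<close>.\<close>

lemma fan_weak_solution: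
  fixes c :: real
  assumes T: "T > 0"
  shows "weak_solution T flow_field (\<lambda>_. 0) (\<lambda>t (x :: real ^ 'n::finite). c * fan t x)"
  unfolding weak_solution_def
proof (intro conjI ballI fan_in_L1_L1loc[OF T])
  fix \<phi> :: "real \<times> (real ^ 'n) \<Rightarrow> real" assume \<phi>: "\<phi> \<in> test_fun T"
  note f = test_fun_facts[OF \<phi> T]
  let ?N = "CARD('n)" and ?S = "{0..T} \<times> (UNIV :: (real ^ 'n) set)"
  let ?W = "fan_region T :: (real \<times> (real ^ 'n)) set"
  let ?D = "test_deriv T \<phi>"
  have WS: "?W \<subseteq> ?S" by (auto simp: fan_region_def)
  have Wb: "?W \<in> sets borel" by (rule fan_region_sets)
  \<comment> \<open>\<open>h\<close> and \<open>k\<close> are \<open>\<partial>\<^sub>t \<phi>\<close> and \<open>div (b \<phi>)\<close> on the cone, extended by 0\<close>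
  define h where "h p = indicator ?W p *\<^sub>R ?D p (1, 0)" for p
  define l where "l p = real ?N * \<phi> p + (\<Sum>i\<in>UNIV. snd p $ i * ?D p (0, axis i 1))" for p
  define k where "k p = indicator ?W p *\<^sub>R (l p / fst p)" for p
  have lc: "continuous_on ?S l"
    unfolding l_def by (intro continuous_intros f)
  have hm[measurable]: "h \<in> borel_measurable borel"
    unfolding h_def by (intro borel_measurable_continuous_on_indicator Wb continuous_on_subset[OF f(2) WS])
  have km[measurable]: "k \<in> borel_measurable borel"
    unfolding k_def using lc
    by (intro borel_measurable_continuous_on_indicator Wb continuous_intros continuous_on_subset[OF lc WS])
       (auto simp: fan_region_def)
  have K: "compact ({0..T} \<times> cball (0 :: real ^ 'n) T)" by (intro compact_Times) auto
  have "bounded (l ` ({0..T} \<times> cball 0 T))" "bounded ((\<lambda>p. ?D p (1, 0)) ` ({0..T} \<times> cball 0 T))"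
    by (intro compact_imp_bounded compact_continuous_image K continuous_on_subset[OF lc] continuous_on_subset[OF f(2)]; auto)+
  then obtain M1 M2 where M: "M1 > 0" "M2 > 0" "\<And>p. p \<in> {0..T} \<times> cball 0 T \<Longrightarrow> \<bar>l p\<bar> \<le> M1"
      "\<And>p. p \<in> {0..T} \<times> cball 0 T \<Longrightarrow> \<bar>?D p (1, 0)\<bar> \<le> M2"
    unfolding bounded_pos by force
  have WK: "?W \<subseteq> {0..T} \<times> cball 0 T" by (auto simp: fan_region_def)
  have kb: "\<bar>k (t, x)\<bar> \<le> M1 / t * indicator ?W (t, x)" for t x
  proof (cases "(t, x) \<in> ?W")
    case True
    then have "t > 0" by (simp add: fan_region_def)
    then show ?thesis using True M(3)[of "(t, x)"] WK by (auto simp: k_def divide_right_mono)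
  qed (simp add: k_def)
  have hb: "\<bar>h (t, x)\<bar> \<le> (M2 * T) / t * indicator ?W (t, x)" for t x
  proof (cases "(t, x) \<in> ?W")
    case True
    then have t: "t > 0" "t < T" by (auto simp: fan_region_def)
    have "\<bar>?D (t, x) (1, 0)\<bar> \<le> M2" using True M(4)[of "(t, x)"] WK by auto
    also have "M2 \<le> (M2 * T) / t" using t M(2) by (simp add: field_simps)
    finally show ?thesis using True by (simp add: h_def)
  qed (simp add: h_def)
  have ki: "integrable (lborel \<Otimes>\<^sub>M lborel) k"
    using kb M T by (intro integrable_fan_region[OF km, of M1 T]) auto
  have hi: "integrable (lborel \<Otimes>\<^sub>M lborel) h"
    using hb M T by (intro integrable_fan_region[OF hm, of "M2 * T" T]) auto
  \<comment> \<open>the sum of both in the self-similar variable, with the Jacobian\<close>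
  define G where "G t y = t ^ ?N * (h (t, t *\<^sub>R y) + k (t, t *\<^sub>R y))" for t y
  have Geq: "G t y = t ^ ?N * (?D (t, t *\<^sub>R y) (1, 0) + l (t, t *\<^sub>R y) / t)"
    if "t \<in> {0<..<T}" "norm y < 1" for t y
    using that by (simp add: G_def h_def k_def fan_region_def)
  have G0: "G t y = 0" if "t \<notin> {0<..<T} \<or> \<not> norm y < 1" for t y
    using that by (auto simp: G_def h_def k_def fan_region_def indicator_def)
  have "(\<lambda>p :: real \<times> (real ^ 'n). (fst p, fst p *\<^sub>R snd p)) \<in> borel \<rightarrow>\<^sub>M borel"
    by (intro borel_measurable_continuous_onI continuous_intros)
  note hkm = measurable_compose[OF this hm] measurable_compose[OF this km]
  have "(\<lambda>p :: real \<times> (real ^ 'n). fst p ^ ?N) \<in> borel_measurable borel"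
    by (intro borel_measurable_continuous_onI continuous_intros)
  then have Gm: "(\<lambda>(t, y). G t y) \<in> borel_measurable (lborel \<Otimes>\<^sub>M lborel)"
    unfolding G_def lborel_prod case_prod_beta using hkm by simp
  have Gb: "\<bar>G t y\<bar> \<le> (T ^ ?N * M2 + T ^ (?N - 1) * M1) * indicator ({0<..<T} \<times> ball 0 1) (t, y)" for t y
  proof (cases "t \<in> {0<..<T} \<and> norm y < 1")
    case True
    then have t: "0 < t" "t < T" and y: "norm y < 1" by auto
    have "(t, t *\<^sub>R y) \<in> ?W" using t y by (simp add: fan_region_def)
    then have "(t, t *\<^sub>R y) \<in> {0..T} \<times> cball 0 T" using WK by blast
    note b = M(3,4)[OF this]
    have "G t y = t ^ ?N * ?D (t, t *\<^sub>R y) (1, 0) + t ^ (?N - 1) * l (t, t *\<^sub>R y)"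
      using t y by (simp add: Geq power_eq_if[of t ?N] field_simps)
    also have "\<bar>\<dots>\<bar> \<le> t ^ ?N * M2 + t ^ (?N - 1) * M1"
      using b t by (intro order_trans[OF abs_triangle_ineq] add_mono) (auto simp: abs_mult intro!: mult_left_mono)
    also have "\<dots> \<le> T ^ ?N * M2 + T ^ (?N - 1) * M1"
      using t M by (intro add_mono mult_right_mono power_mono) auto
    finally show ?thesis using True by simp
  qed (use G0[of t y] in \<open>auto simp: indicator_def\<close>)
  have Gi: "integrable (lborel \<Otimes>\<^sub>M lborel) (\<lambda>(t, y). G t y)"
  proof (rule Bochner_Integration.integrable_bound[OF _ Gm])
    have "bounded ({0<..<T} \<times> ball (0 :: real ^ 'n) 1)" by (intro bounded_Times) auto
    then have "emeasure lborel ({0<..<T} \<times> ball (0 :: real ^ 'n) 1) < \<infinity>" by (rule emeasure_bounded_finite)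
    then have "integrable (lborel :: (real \<times> (real ^ 'n)) measure) (indicator ({0<..<T} \<times> ball (0 :: real ^ 'n) 1) :: _ \<Rightarrow> real)"
      by (intro integrable_real_indicator) (auto intro!: borel_open open_Times)
    then show "integrable (lborel \<Otimes>\<^sub>M lborel)
        (\<lambda>p. (T ^ ?N * M2 + T ^ (?N - 1) * M1) * indicator ({0<..<T} \<times> ball (0 :: real ^ 'n) 1) p)"
      unfolding lborel_prod by (rule integrable_mult_right)
    show "AE p in lborel \<Otimes>\<^sub>M lborel. norm (case p of (t, y) \<Rightarrow> G t y)
        \<le> norm ((T ^ ?N * M2 + T ^ (?N - 1) * M1) * indicator ({0<..<T} \<times> ball (0 :: real ^ 'n) 1) p)"
      using Gb by (intro AE_I2) (auto intro: order_trans[OF _ abs_ge_self])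
  qed
  have Gt: "(LINT t|lborel. G t y) = 0" for y
  proof (cases "norm y < 1")
    case y: True
    have ti: "integrable lborel (\<lambda>t. G t y)"
    proof (rule Bochner_Integration.integrable_bound)
      show "integrable lborel (\<lambda>t. (T ^ ?N * M2 + T ^ (?N - 1) * M1) * indicator {0<..<T} t)"
        using T by (intro integrable_mult_right integrable_real_indicator) auto
      have "(\<lambda>t. (t, t *\<^sub>R y)) \<in> borel \<rightarrow>\<^sub>M borel"
        by (intro borel_measurable_continuous_onI continuous_intros)
      from measurable_compose[OF this hm] measurable_compose[OF this km]
      show "(\<lambda>t. G t y) \<in> borel_measurable lborel" unfolding G_def by simp
      show "AE t in lborel. norm (G t y) \<le> norm ((T ^ ?N * M2 + T ^ (?N - 1) * M1) * indicator {0<..<T} t)"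
        using Gb[of _ y] y M T by (intro AE_I2) (auto simp: indicator_def split: if_splits)
    qed
    have "((\<lambda>t. t ^ ?N * (?D (t, t *\<^sub>R y) (1, 0) + l (t, t *\<^sub>R y) / t)) has_integral
        (T ^ ?N * \<phi> (T, T *\<^sub>R y) - 0 ^ ?N * \<phi> (0, 0 *\<^sub>R y))) {0..T}"
    proof (rule fundamental_theorem_of_calculus_interior)
      show "continuous_on {0..T} (\<lambda>t. t ^ ?N * \<phi> (t, t *\<^sub>R y))"
        by (intro continuous_intros continuous_on_compose2[OF f(1)]) auto
      show "((\<lambda>t. t ^ ?N * \<phi> (t, t *\<^sub>R y)) has_vector_derivative
          t ^ ?N * (?D (t, t *\<^sub>R y) (1, 0) + l (t, t *\<^sub>R y) / t)) (at t)" if "t \<in> {0<..<T}" for t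
        using fan_test_derivative[OF \<phi> T, of t y] that
        by (simp add: l_def has_real_derivative_iff_has_vector_derivative)
    qed (use T in auto)
    then have "((\<lambda>t. t ^ ?N * (?D (t, t *\<^sub>R y) (1, 0) + l (t, t *\<^sub>R y) / t)) has_integral 0) {0<..<T}"
      using f(4) by (simp add: has_integral_Icc_iff_Ioo zero_power)
    then have "((\<lambda>t. if t \<in> {0<..<T} then t ^ ?N * (?D (t, t *\<^sub>R y) (1, 0) + l (t, t *\<^sub>R y) / t) else 0) has_integral 0) UNIV"
      by (simp only: has_integral_restrict_UNIV)
    also have "(\<lambda>t. if t \<in> {0<..<T} then t ^ ?N * (?D (t, t *\<^sub>R y) (1, 0) + l (t, t *\<^sub>R y) / t) else 0) = (\<lambda>t. G t y)"
      using Geq[OF _ y] G0[of _ y] by (auto simp: fun_eq_iff)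
    finally show ?thesis
      using has_integral_integral_lborel[OF ti] has_integral_unique by blast
  qed (simp add: G0)
  have "(LINT t|lborel. LINT x|lborel. h (t, x)) + (LINT t|lborel. LINT x|lborel. k (t, x))
      = (LINT p|(lborel \<Otimes>\<^sub>M lborel). h p) + (LINT p|(lborel \<Otimes>\<^sub>M lborel). k p)"
    using hi ki by (simp add: lborel_pair.integral_fst')
  also have "\<dots> = (LINT p|(lborel \<Otimes>\<^sub>M lborel). h p + k p)"
    using hi ki by simp
  also have "\<dots> = (LINT t|lborel. LINT x|lborel. h (t, x) + k (t, x))"
    using hi ki by (subst lborel_pair.integral_fst'[symmetric]) auto
  also have "\<dots> = (LINT t|lborel. LINT y|lborel. G t y)"
  proof (rule Bochner_Integration.integral_cong[OF refl])
    fix t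
    show "(LINT x|lborel. h (t, x) + k (t, x)) = (LINT y|lborel. G t y)"
    proof (cases "t > 0")
      case True
      then show ?thesis
        using integral_dilate[of "\<lambda>x. h (t, x) + k (t, x)" t] by (simp add: G_def)
    next
      case False
      then have "h (t, x) + k (t, x) = 0" "G t x = 0" for x
        by (auto simp: h_def k_def G_def fan_region_def)
      then show ?thesis by simp
    qed
  qed
  also have "\<dots> = (LINT y|lborel. LINT t|lborel. G t y)"
    using Gi by (rule lborel_pair.Fubini_integral[symmetric])
  also have "\<dots> = 0" by (simp add: Gt)
  finally have zero: "(LINT t|lborel. LINT x|lborel. h (t, x)) + (LINT t|lborel. LINT x|lborel. k (t, x)) = 0" .
  have uh: "c * fan t x * deriv (\<lambda>s. \<phi> (s, x)) t = c * h (t, x)" if t: "t \<in> {0<..<T}" for t x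
  proof -
    have "((\<lambda>s. (s, x)) has_derivative (\<lambda>s. (s, 0))) (at t)"
      by (intro has_derivative_Pair has_derivative_const has_derivative_ident)
    from has_derivative_compose[OF this f(3)] t
    have d: "((\<lambda>s. \<phi> (s, x)) has_derivative (\<lambda>s. ?D (t, x) (s, 0))) (at t)" by simp
    have "?D (t, x) (s, 0) = ?D (t, x) (1, 0) * s" for s
      using linear_scale[OF has_derivative_linear[OF f(3)], of t x s "(1, 0)"] t by simp
    then have eq: "(\<lambda>s. ?D (t, x) (s, 0)) = (*) (?D (t, x) (1, 0))" by (rule ext)
    have "deriv (\<lambda>s. \<phi> (s, x)) t = ?D (t, x) (1, 0)"
      by (intro DERIV_imp_deriv) (rule d[unfolded eq, folded has_field_derivative_def])
    then show ?thesis using t by (simp add: h_def fan_eq fan_region_def)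
  qed
  have uk: "c * fan t x * test_div T \<phi> t x = c * k (t, x)" if t: "t \<in> {0<..<T}" for t x
    using t test_div_inside[of t x T \<phi>] by (simp add: fan_eq k_def l_def fan_region_def)
  have h0: "c * h (t, x) = 0" "c * k (t, x) = 0" if "t \<notin> {0<..<T}" for t x
    using that by (auto simp: h_def k_def fan_region_def)
  have 1: "(LINT t|lebesgue_on {0<..<T}. LINT x|lebesgue. c * fan t x * deriv (\<lambda>s. \<phi> (s, x)) t)
      = c * (LINT t|lborel. LINT x|lborel. h (t, x))"
    using iterated_lebesgue_eq_lborel[of "\<lambda>p. c * h p", OF _ h0(1) uh] by simp
  have 2: "(LINT t|lebesgue_on {0<..<T}. LINT x|lebesgue. c * fan t x * test_div T \<phi> t x)
      = c * (LINT t|lborel. LINT x|lborel. k (t, x))"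
    using iterated_lebesgue_eq_lborel[of "\<lambda>p. c * k p", OF _ h0(2) uk] by simp
  show "\<exists>D. (AE t in lebesgue_on {0<..<T}. has_weak_div (\<lambda>x. \<phi> (t, x) *\<^sub>R flow_field t x) (D t)) \<and>
        integrable (lebesgue_on (slab T)) (\<lambda>(t, x). c * fan t x * D t x) \<and>
        - (LINT t|lebesgue_on {0<..<T}. LINT x|lebesgue. c * fan t x * deriv (\<lambda>s. \<phi> (s, x)) t)
        - (LINT x|lebesgue. 0 * \<phi> (0, x))
        - (LINT t|lebesgue_on {0<..<T}. LINT x|lebesgue. c * fan t x * D t x) = 0"
  proof (intro exI[of _ "test_div T \<phi>"] conjI)
    show "AE t in lebesgue_on {0<..<T}. has_weak_div (\<lambda>x. \<phi> (t, x) *\<^sub>R flow_field t x) (test_div T \<phi> t)"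
      by (intro AE_I2 has_weak_div_test_div[OF \<phi> T]) auto
    have "(\<lambda>p. indicator (slab T) p *\<^sub>R (case p of (t, x) \<Rightarrow> c * fan t x * test_div T \<phi> t x)) = (\<lambda>p. c * k p)"
      using uk h0(2) by (fastforce simp: fun_eq_iff slab_def indicator_def)
    moreover have "integrable lebesgue (\<lambda>p. c * k p)"
      using ki unfolding lborel_prod by (subst integrable_completion) auto
    ultimately show "integrable (lebesgue_on (slab T)) (\<lambda>(t, x). c * fan t x * test_div T \<phi> t x)"
      by (subst integrable_restrict_space) (auto simp: slab_sets)
    show "- (LINT t|lebesgue_on {0<..<T}. LINT x|lebesgue. c * fan t x * deriv (\<lambda>s. \<phi> (s, x)) t)
        - (LINT x|lebesgue. 0 * \<phi> (0, x))
        - (LINT t|lebesgue_on {0<..<T}. LINT x|lebesgue. c * fan t x * test_div T \<phi> t x) = 0"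
      using arg_cong[OF zero, of "\<lambda>z. c * z"] unfolding 1 2 by (simp add: distrib_left)
  qed
qed

theorem theorem7:
  fixes T \<gamma> :: real
  assumes "T > 0" and "\<gamma> > 1"
  shows "\<exists>b :: real \<Rightarrow> real ^ 'n \<Rightarrow> real ^ 'n.
           b \<in> L1_W11loc T \<and> b \<in> Linf_Linf T \<and> div_in_L1_Exp T \<gamma> b \<and>
           (\<exists>u0\<in>Cc_smooth UNIV.
              infinite ({u. weak_solution T b u0 u \<and> u \<in> Linf_Linf T} // slab_ae_eq T))"
proof (intro exI[of _ flow_field] conjI bexI)
  show "infinite ({u. weak_solution T flow_field (\<lambda>_. 0) u \<and> u \<in> Linf_Linf T} // slab_ae_eq T)"
    by (rule fan_infinitely_many_classes[OF assms(1)])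
       (simp add: fan_weak_solution[OF assms(1)] fan_in_Linf_Linf)
qed (intro field_in_L1_W11loc field_in_Linf_Linf field_div_in_L1_Exp zero_Cc_smooth assms)+

end
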